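(* Let $m\in\mathbb{N}$, $n_1,\dots,n_m\in\mathbb{N}$ and set $N=n_1+\dots+n_m$. Let $H$ be a $k$-dimensional linear subspace of $\mathbb{R}^N=\bigoplus_{j=1}^m\mathbb{R}^{n_j}$. Then, for every family of functions $f_j\in\mathcal{S}(\mathbb{R}^{n_j})$, $1\le j\le m$, we have $$\int_H\prod_{j=1}^m f_j(P_{\mathbb{R}^{n_j}}y)\,dy=\frac{1}{(2\pi)^{N-k}}\int_{H^\perp}\prod_{j=1}^m\widehat{f_j}(P_{\mathbb{R}^{n_j}}z)\,dz.$$
   Context: $\mathcal{S}(\mathbb{R}^d)$ is the Schwartz space of rapidly decreasing smooth functions $f:\mathbb{R}^d\to\mathbb{R}$. The Fourier transform is $\widehat f(y)=\int_{\mathbb{R}^d}f(x)e^{i\langle x,y\rangle}dx$. $P_{\mathbb{R}^{n_j}}$ is the orthogonal projection of $\mathbb{R}^N$ onto the $j$-th summand $\mathbb{R}^{n_j}$ of the orthogonal direct sum. $H^\perp$ is the orthogonal complement of $H$ in $\mathbb{R}^N$. Integrals over $H$ and $H^\perp$ are with respect to the Lebesgue measure induced by the Euclidean structure. *)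

theory Defs
  imports "HOL-Analysis.Analysis"
begin

text \<open>
  The spaces \<open>\<real>\<^sup>n\<close> whose dimension depends on an index are represented as linear subspaces \<open>S\<close>
  of one Euclidean space \<open>'a\<close>, with the inherited inner product. A function on \<open>S\<close> is a total
  function on \<open>'a\<close>; none of the notions below looks at its values outside \<open>S\<close>.
\<close>

definition orthonormal_basis :: "'a::euclidean_space set \<Rightarrow> 'a set \<Rightarrow> bool" where
  "orthonormal_basis S B \<longleftrightarrow>
     pairwise orthogonal B \<and> (\<forall>b\<in>B. norm b = 1) \<and> span B = S"

text \<open>
  Lebesgue measure of a linear subspace \<open>S\<close>, as a measure with underlying space \<open>S\<close>: the product
  Lebesgue measure in orthonormal coordinates, just as \<^const>\<open>lborel\<close> is defined from
  \<^const>\<open>Basis\<close>. By rotation invariance the choice of the orthonormal basis is immaterial.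
  For \<open>S = {0}\<close> this is the unit point mass.
\<close>
definition subspace_lborel :: "'a::euclidean_space set \<Rightarrow> 'a measure" where
  "subspace_lborel S =
     (let B = (SOME B. orthonormal_basis S B)
      in distr (\<Pi>\<^sub>M b\<in>B. lborel) (restrict_space borel S) (\<lambda>c. \<Sum>b\<in>B. c b *\<^sub>R b))"

definition orthogonal_proj :: "'a::euclidean_space set \<Rightarrow> 'a \<Rightarrow> 'a" where
  "orthogonal_proj S x = (THE p. p \<in> S \<and> x - p \<in> S\<^sup>\<bottom>)"

definition dir_deriv :: "'a::euclidean_space \<Rightarrow> ('a \<Rightarrow> real) \<Rightarrow> 'a \<Rightarrow> real" where
  "dir_deriv v f x = deriv (\<lambda>t. f (x + t *\<^sub>R v)) 0"

text \<open>
  \<open>foldr dir_deriv vs f\<close> is the iterated derivative of \<open>f\<close> along the directions in the list \<open>vs\<close>.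
  Letting \<open>vs\<close> range over lists in \<open>S\<close> covers all partial derivatives of all orders in any
  coordinates of \<open>S\<close>.
\<close>
definition smooth_on_subspace :: "'a::euclidean_space set \<Rightarrow> ('a \<Rightarrow> real) \<Rightarrow> bool" where
  "smooth_on_subspace S f \<longleftrightarrow>
     (\<forall>vs. set vs \<subseteq> S \<longrightarrow>
        continuous_on S (foldr dir_deriv vs f) \<and>
        (\<forall>x\<in>S. \<forall>v\<in>S. (\<lambda>t::real. foldr dir_deriv vs f (x + t *\<^sub>R v)) differentiable at 0))"

definition schwartz_space :: "'a::euclidean_space set \<Rightarrow> ('a \<Rightarrow> real) set" where
  "schwartz_space S =
     {f. smooth_on_subspace S f \<and>
         (\<forall>vs p. set vs \<subseteq> S \<longrightarrow>
            bounded ((\<lambda>x. norm x ^ p * foldr dir_deriv vs f x) ` S))}"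

definition fourier_transform ::
    "'a::euclidean_space set \<Rightarrow> ('a \<Rightarrow> real) \<Rightarrow> 'a \<Rightarrow> complex" where
  "fourier_transform S f y =
     (\<integral>x. complex_of_real (f x) * exp (\<i> * complex_of_real (x \<bullet> y)) \<partial>subspace_lborel S)"

end

theory Submission
  imports Defs "HOL-Probability.Characteristic_Functions" "HOL-Probability.Sinc_Integral"
begin

text \<open>
  The theorem is Fourier inversion at the origin of \<open>H\<^sup>\<bottom>\<close>. Put \<open>F x = (\<Prod>j. f j (P j x))\<close>, where \<open>P j\<close>
  is the projection to the \<open>j\<close>-th summand. By Fubini the Fourier transform of \<open>F\<close> on the whole
  space is the product of the transforms of the \<open>f j\<close> at the projections of \<open>z\<close>
  (\<open>integral_prod_orthogonal_proj\<close>), and its restriction to \<open>H\<^sup>\<bottom>\<close> is the Fourier transform of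
  \<open>u \<mapsto> \<integral>\<^sub>H F (y + u) dy\<close>. The left-hand side is the value of this function at \<open>u = 0\<close>. The inversion
  is done by Gaussian regularisation directly for \<open>F\<close>
  (\<open>integral_subspace_eq_integral_fourier\<close>).

  Two things have to be supplied. One is that the right-hand integral converges absolutely. This is
  where smoothness enters: transforming directional derivatives
  (\<open>fourier_dir_deriv\<close>) shows that the transform of a Schwartz function decays faster than any
  power (\<open>fourier_decay\<close>), and decay on the summands multiplies to decay on the whole space
  (\<open>prod_orthogonal_proj_decay\<close>).

  The other is that Lebesgue measures on subspaces, each defined by its own unspecified orthonormal
  basis, fit together: the measure of an orthogonal sum must be the product measure
  (\<open>subspace_lborel_orthogonal_sum\<close>), and dilations must scale it correctly
  (\<open>integral_scaled\<close>). Both follow from a uniqueness principle: a \<open>\<sigma>\<close>-finite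
  translation-invariant measure is determined by the integral of one even kernel
  (\<open>translation_invariant_unique\<close>, \<open>subspace_lborel_eqI\<close>), and the Gaussian integral can be computed
  in any orthonormal coordinates.
\<close>

section \<open>Orthonormal coordinates and orthogonal projections\<close>

text \<open>
  The basis that \<^const>\<open>subspace_lborel\<close> picks, named so that statements in coordinates can
  refer to it.
\<close>
definition coord_basis :: "'a::euclidean_space set \<Rightarrow> 'a set" where
  "coord_basis S = (SOME B. orthonormal_basis S B)"

lemma subspace_lborel_coordinates:
  "subspace_lborel S = distr (\<Pi>\<^sub>M b\<in>coord_basis S. lborel) (restrict_space borel S)
      (\<lambda>c. \<Sum>b\<in>coord_basis S. c b *\<^sub>R b)"
  by (simp add: subspace_lborel_def coord_basis_def Let_def)

lemma coord_basis:
  fixes S :: "'a::euclidean_space set"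
  assumes "subspace S"
  shows "orthonormal_basis S (coord_basis S)" "finite (coord_basis S)"
    "card (coord_basis S) = dim S" "coord_basis S \<subseteq> S"
proof -
  obtain B' where "pairwise orthogonal B'" "\<And>x. x \<in> B' \<Longrightarrow> norm x = 1" "span B' = S"
    using orthonormal_basis_subspace[OF assms] by metis
  then have "\<exists>B. orthonormal_basis S B"
    unfolding orthonormal_basis_def by blast
  then show B: "orthonormal_basis S (coord_basis S)"
    unfolding coord_basis_def by (rule someI_ex)
  then have ind: "independent (coord_basis S)"
    by (intro pairwise_orthogonal_independent) (auto simp: orthonormal_basis_def)
  from B have span: "span (coord_basis S) = S" by (simp add: orthonormal_basis_def)
  show "finite (coord_basis S)" using ind by (rule independent_imp_finite)
  show "card (coord_basis S) = dim S"
    using dim_span_eq_card_independent[OF ind] unfolding span by (rule sym)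
  show "coord_basis S \<subseteq> S"
    using span_superset[of "coord_basis S"] unfolding span .
qed

lemma orthonormal_inner_sum:
  assumes "orthonormal_basis S B" "finite B" "b \<in> B"
  shows "(\<Sum>a\<in>B. c a *\<^sub>R a) \<bullet> b = c b"
proof -
  have "(\<Sum>a\<in>B. c a *\<^sub>R a) \<bullet> b = (\<Sum>a\<in>B. if a = b then c b else 0)"
    unfolding inner_sum_left
  proof (rule sum.cong[OF refl])
    fix a assume "a \<in> B"
    with assms show "c a *\<^sub>R a \<bullet> b = (if a = b then c b else 0)"
      by (auto simp: orthonormal_basis_def pairwise_def orthogonal_def dot_square_norm)
  qed
  with assms show ?thesis by simp
qed

lemma orthonormal_expansion:
  assumes "orthonormal_basis S B" "finite B" "x \<in> S"
  shows "(\<Sum>b\<in>B. (x \<bullet> b) *\<^sub>R b) = x"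
proof -
  from assms have "x \<in> span B" by (simp add: orthonormal_basis_def)
  then obtain c where "x = (\<Sum>b\<in>B. c b *\<^sub>R b)"
    using span_finite[OF assms(2)] by auto
  then show ?thesis
    using orthonormal_inner_sum[OF assms(1,2)] by (simp cong: sum.cong)
qed

lemma orthonormal_norm_sum:
  assumes "orthonormal_basis S B" "finite B"
  shows "(norm (\<Sum>b\<in>B. c b *\<^sub>R b))\<^sup>2 = (\<Sum>b\<in>B. (c b)\<^sup>2)"
  unfolding power2_norm_eq_inner inner_sum_right inner_scaleR_right power2_eq_square[of "c _"]
  by (intro sum.cong refl) (simp add: orthonormal_inner_sum[OF assms])

text \<open>
  Turns the definite description into a usable characterisation: coordinates in an orthonormal
  basis provide a point with both properties, and two such points differ by a vector of
  \<open>S \<inter> S\<^sup>\<bottom> = {0}\<close>.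
\<close>
lemma orthogonal_proj_eq_iff:
  assumes S: "subspace S"
  shows "orthogonal_proj S x = p \<longleftrightarrow> p \<in> S \<and> x - p \<in> S\<^sup>\<bottom>"
proof -
  note B = coord_basis(1,2,4)[OF S]
  have ex: "\<exists>p. p \<in> S \<and> x - p \<in> S\<^sup>\<bottom>"
  proof (intro exI conjI)
    let ?p = "\<Sum>b\<in>coord_basis S. (x \<bullet> b) *\<^sub>R b"
    show "?p \<in> S" using S B(3) by (intro subspace_sum subspace_scale) auto
    have "y \<bullet> (x - ?p) = 0" if "y \<in> S" for y
    proof -
      have "x \<bullet> y = x \<bullet> (\<Sum>b\<in>coord_basis S. (y \<bullet> b) *\<^sub>R b)"
        by (simp add: orthonormal_expansion[OF B(1,2) that])
      then show ?thesis
        by (simp add: inner_diff_right inner_sum_right inner_commute mult.commute)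
    qed
    then show "x - ?p \<in> S\<^sup>\<bottom>" by (simp add: orthogonal_comp_def orthogonal_def)
  qed
  have uniq: "p = q" if "p \<in> S" "q \<in> S" "x - p \<in> S\<^sup>\<bottom>" "x - q \<in> S\<^sup>\<bottom>" for p q
  proof -
    have "(x - q) - (x - p) \<in> S\<^sup>\<bottom>" using that by (blast intro: subspace_diff[OF subspace_orthogonal_comp])
    then have "p - q \<in> S\<^sup>\<bottom>" by simp
    moreover have "p - q \<in> S" using that S by (intro subspace_diff)
    ultimately have "(p - q) \<bullet> (p - q) = 0" by (auto simp: orthogonal_comp_def orthogonal_def)
    then show ?thesis by simp
  qed
  have "\<exists>!p. p \<in> S \<and> x - p \<in> S\<^sup>\<bottom>" using ex uniq by blast
  then show ?thesis unfolding orthogonal_proj_def using theI'[of "\<lambda>p. p \<in> S \<and> x - p \<in> S\<^sup>\<bottom>"] uniq by blast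
qed

lemma orthogonal_proj_in: "subspace S \<Longrightarrow> orthogonal_proj S x \<in> S"
  using orthogonal_proj_eq_iff by blast

lemma inner_orthogonal_proj: "subspace S \<Longrightarrow> y \<in> S \<Longrightarrow> orthogonal_proj S x \<bullet> y = x \<bullet> y"
  using orthogonal_proj_eq_iff[of S x "orthogonal_proj S x"]
  by (auto simp: orthogonal_comp_def orthogonal_def inner_diff_right inner_diff_left inner_commute)

lemma orthogonal_proj_ident: "subspace S \<Longrightarrow> x \<in> S \<Longrightarrow> orthogonal_proj S x = x"
  by (simp add: orthogonal_proj_eq_iff subspace_0[OF subspace_orthogonal_comp])

lemma orthogonal_proj_0: "subspace S \<Longrightarrow> x \<in> S\<^sup>\<bottom> \<Longrightarrow> orthogonal_proj S x = 0"
  by (simp add: orthogonal_proj_eq_iff subspace_0)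

lemma linear_orthogonal_proj:
  assumes S: "subspace S" shows "linear (orthogonal_proj S)"
proof (rule linearI)
  have P: "orthogonal_proj S x \<in> S" "x - orthogonal_proj S x \<in> S\<^sup>\<bottom>" for x
    using orthogonal_proj_eq_iff[OF S] by blast+
  show "orthogonal_proj S (x + y) = orthogonal_proj S x + orthogonal_proj S y" for x y
    using subspace_add[OF subspace_orthogonal_comp P(2)[of x] P(2)[of y]] P(1)
    by (simp add: orthogonal_proj_eq_iff[OF S] subspace_add[OF S] algebra_simps)
  show "orthogonal_proj S (c *\<^sub>R x) = c *\<^sub>R orthogonal_proj S x" for c x
    using subspace_scale[OF subspace_orthogonal_comp P(2)[of x], of c] P(1)
    by (simp add: orthogonal_proj_eq_iff[OF S] subspace_scale[OF S] algebra_simps)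
qed

lemma continuous_orthogonal_proj: "subspace S \<Longrightarrow> continuous_on A (orthogonal_proj S)"
  using linear_orthogonal_proj by (rule linear_continuous_on[OF linear_conv_bounded_linear[THEN iffD1]])

lemma borel_measurable_orthogonal_proj: "subspace S \<Longrightarrow> orthogonal_proj S \<in> borel_measurable borel"
  by (intro borel_measurable_continuous_onI continuous_orthogonal_proj)

lemma span_Un_orthogonal_comp:
  fixes H :: "'a::euclidean_space set"
  shows "subspace H \<Longrightarrow> span (H \<union> H\<^sup>\<bottom>) = UNIV"
  using subspace_sum_orthogonal_comp[of H]
  by (fastforce simp: span_Un span_eq_iff[THEN iffD2] subspace_orthogonal_comp set_plus_def)

text \<open>
  The difference of the two sides is orthogonal to each summand, hence to their span, which is
  everything.
\<close>
lemma sum_orthogonal_proj: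
  fixes E :: "'i \<Rightarrow> 'a::euclidean_space set"
  assumes J: "finite J" and E: "\<And>j. j \<in> J \<Longrightarrow> subspace (E j)"
    and orth: "\<And>i j x y. i \<in> J \<Longrightarrow> j \<in> J \<Longrightarrow> i \<noteq> j \<Longrightarrow> x \<in> E i \<Longrightarrow> y \<in> E j \<Longrightarrow> orthogonal x y"
    and span: "span (\<Union>j\<in>J. E j) = UNIV"
  shows "(\<Sum>j\<in>J. orthogonal_proj (E j) x) = x"
proof -
  let ?r = "x - (\<Sum>j\<in>J. orthogonal_proj (E j) x)"
  have "orthogonal ?r y" if y: "y \<in> (\<Union>j\<in>J. E j)" for y
  proof -
    obtain i where i: "i \<in> J" "y \<in> E i" using y by blast
    have "(\<Sum>j\<in>J. orthogonal_proj (E j) x \<bullet> y) = (\<Sum>j\<in>J. if j = i then x \<bullet> y else 0)"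
    proof (rule sum.cong[OF refl])
      fix j assume j: "j \<in> J"
      show "orthogonal_proj (E j) x \<bullet> y = (if j = i then x \<bullet> y else 0)"
        using orth[OF j i(1) _ orthogonal_proj_in[OF E[OF j]] i(2)] inner_orthogonal_proj[OF E[OF i(1)] i(2)]
        by (auto simp: orthogonal_def)
    qed
    then show ?thesis using J i(1) by (simp add: orthogonal_def inner_diff_left inner_sum_left)
  qed
  then have "orthogonal ?r y" if "y \<in> span (\<Union>j\<in>J. E j)" for y
    using that by (rule orthogonal_to_span[rotated])
  then have "orthogonal ?r ?r" unfolding span by blast
  then show ?thesis by (simp add: orthogonal_self)
qed

section \<open>Translation invariance of Lebesgue measure on a subspace\<close>

lemma space_subspace_lborel [simp]: "space (subspace_lborel S) = S"
  by (simp add: subspace_lborel_def Let_def space_restrict_space)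

lemma sets_subspace_lborel:
  "sets (subspace_lborel S) = sets (restrict_space borel S)"
  by (simp add: subspace_lborel_def Let_def)

lemma measurable_subspace_lborel_eq:
  "measurable (subspace_lborel S) N = measurable (restrict_space borel S) N"
  "measurable N (subspace_lborel S) = measurable N (restrict_space borel S)"
  by (simp_all add: sets_subspace_lborel cong: measurable_cong_sets)

lemma measurable_subspace_lborel_ident: "(\<lambda>x. x) \<in> borel_measurable (subspace_lborel S)"
  using measurable_restrict_space1[OF measurable_ident_sets[OF refl], of borel S]
  by (simp add: measurable_cong_sets[OF sets_subspace_lborel refl])

lemma borel_measurable_subspace_lborel:
  "f \<in> borel_measurable borel \<Longrightarrow> f \<in> borel_measurable (subspace_lborel S)"
  by (rule measurable_compose[OF measurable_subspace_lborel_ident])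

lemma measurable_coordinates:
  assumes "orthonormal_basis S B" "finite B"
  shows "(\<lambda>c. \<Sum>b\<in>B. c b *\<^sub>R b) \<in> measurable (\<Pi>\<^sub>M b\<in>B. lborel) (restrict_space borel S)"
proof (rule measurable_restrict_space2)
  show "(\<lambda>c. \<Sum>b\<in>B. c b *\<^sub>R b) \<in> space (\<Pi>\<^sub>M b\<in>B. lborel) \<rightarrow> S"
    using assms by (auto simp: orthonormal_basis_def intro: span_sum span_scale span_base)
  have "(\<lambda>c. c b) \<in> borel_measurable (\<Pi>\<^sub>M b\<in>B. lborel)" if "b \<in> B" for b :: 'a
    using measurable_component_singleton[OF that, of "\<lambda>_. lborel"] by simp
  then show "(\<lambda>c. \<Sum>b\<in>B. c b *\<^sub>R b) \<in> borel_measurable (\<Pi>\<^sub>M b\<in>B. lborel)"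
    by (intro borel_measurable_sum borel_measurable_scaleR) auto
qed

text \<open>
  A product measure is determined by its values on boxes, so translation invariance in each
  coordinate is enough.
\<close>
lemma product_lborel_translate:
  fixes B :: "'a set" and a :: "'a \<Rightarrow> real"
  assumes "finite B"
  shows "distr (\<Pi>\<^sub>M b\<in>B. lborel) (\<Pi>\<^sub>M b\<in>B. lborel) (\<lambda>c. \<lambda>b\<in>B. c b + a b) = (\<Pi>\<^sub>M b\<in>B. lborel)"
proof -
  interpret product_sigma_finite "\<lambda>_::'a. lborel :: real measure" ..
  have meas: "(\<lambda>c. \<lambda>b\<in>B. c b + a b) \<in> measurable (\<Pi>\<^sub>M b\<in>B. lborel) (\<Pi>\<^sub>M b\<in>B. lborel)"
    by measurable
  show ?thesis
  proof (rule PiM_eqI[OF assms])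
    fix A :: "'a \<Rightarrow> real set" assume A: "\<And>i. i \<in> B \<Longrightarrow> A i \<in> sets lborel"
    have shift: "(\<lambda>x. x + t) -` X \<in> sets borel" if "X \<in> sets borel" for t :: real and X
      using measurable_sets[of "\<lambda>x. x + t" borel borel X] that by simp
    have vim: "(\<lambda>c. \<lambda>b\<in>B. c b + a b) -` Pi\<^sub>E B A \<inter> space (\<Pi>\<^sub>M b\<in>B. lborel)
        = Pi\<^sub>E B (\<lambda>b. (\<lambda>x. x + a b) -` A b)"
      by (auto simp: space_PiM PiE_iff extensional_def)
    have "emeasure (distr (\<Pi>\<^sub>M b\<in>B. lborel) (\<Pi>\<^sub>M b\<in>B. lborel) (\<lambda>c. \<lambda>b\<in>B. c b + a b)) (Pi\<^sub>E B A)
        = emeasure (\<Pi>\<^sub>M b\<in>B. lborel) (Pi\<^sub>E B (\<lambda>b. (\<lambda>x. x + a b) -` A b))"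
      using A assms by (subst emeasure_distr[OF meas]) (auto simp: vim)
    also have "\<dots> = (\<Prod>b\<in>B. emeasure lborel ((\<lambda>x. x + a b) -` A b))"
      using A assms shift by (intro emeasure_PiM) auto
    also have "\<dots> = (\<Prod>b\<in>B. emeasure lborel (A b))"
    proof (rule prod.cong[OF refl])
      fix b assume b: "b \<in> B"
      have "emeasure lborel (A b) = emeasure (distr lborel borel ((+) (a b))) (A b)"
        by (simp add: lborel_distr_plus)
      also have "\<dots> = emeasure lborel ((+) (a b) -` A b)"
        using A[OF b] by (subst emeasure_distr) auto
      also have "(+) (a b) -` A b = (\<lambda>x. x + a b) -` A b" by (auto simp: add.commute)
      finally show "emeasure lborel ((\<lambda>x. x + a b) -` A b) = emeasure lborel (A b)" by simp
    qed
    finally show "emeasure (distr (\<Pi>\<^sub>M b\<in>B. lborel) (\<Pi>\<^sub>M b\<in>B. lborel) (\<lambda>c. \<lambda>b\<in>B. c b + a b)) (Pi\<^sub>E B A)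
      = (\<Prod>b\<in>B. emeasure lborel (A b))" .
  qed simp
qed

lemma measurable_subspace_add:
  fixes S :: "'a::euclidean_space set"
  assumes "subspace S" "v \<in> S"
  shows "(\<lambda>x. x + v) \<in> measurable (restrict_space borel S) (restrict_space borel S)"
proof (intro measurable_restrict_space2 measurable_restrict_space1)
  show "(\<lambda>x. x + v) \<in> space (restrict_space borel S) \<rightarrow> S"
    using assms by (auto simp: space_restrict_space intro: subspace_add)
qed simp

lemma subspace_lborel_translate:
  fixes S :: "'a::euclidean_space set"
  assumes S: "subspace S" and v: "v \<in> S"
  shows "distr (subspace_lborel S) (restrict_space borel S) (\<lambda>x. x + v) = subspace_lborel S"
proof -
  let ?B = "coord_basis S"
  let ?P = "\<Pi>\<^sub>M b\<in>?B. (lborel :: real measure)" and ?s = "\<lambda>c. \<Sum>b\<in>?B. c b *\<^sub>R b"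
  note B = coord_basis(1,2)[OF S] and eq = subspace_lborel_coordinates[of S]
  note s = measurable_coordinates[OF B]
  have t: "(\<lambda>c. \<lambda>b\<in>?B. c b + v \<bullet> b) \<in> measurable ?P ?P" by measurable
  have "distr (subspace_lborel S) (restrict_space borel S) (\<lambda>x. x + v)
      = distr ?P (restrict_space borel S) ((\<lambda>x. x + v) \<circ> ?s)"
    unfolding eq by (rule distr_distr[OF measurable_subspace_add[OF S v] s])
  also have "(\<lambda>x. x + v) \<circ> ?s = ?s \<circ> (\<lambda>c. \<lambda>b\<in>?B. c b + v \<bullet> b)"
    by (rule ext) (simp add: scaleR_add_left sum.distrib orthonormal_expansion[OF B v])
  also have "distr ?P (restrict_space borel S) \<dots> = distr (distr ?P ?P (\<lambda>c. \<lambda>b\<in>?B. c b + v \<bullet> b)) (restrict_space borel S) ?s"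
    by (rule distr_distr[OF s t, symmetric])
  also have "\<dots> = subspace_lborel S"
    unfolding product_lborel_translate[OF B(2)] eq ..
  finally show ?thesis .
qed

lemma nn_integral_translate:
  fixes S :: "'a::euclidean_space set"
  assumes S: "subspace S" and v: "v \<in> S" and F: "F \<in> borel_measurable (subspace_lborel S)"
  shows "(\<integral>\<^sup>+x. F (x + v) \<partial>subspace_lborel S) = (\<integral>\<^sup>+x. F x \<partial>subspace_lborel S)"
proof -
  have "(\<lambda>x. x + v) \<in> measurable (subspace_lborel S) (restrict_space borel S)"
    unfolding measurable_subspace_lborel_eq by (rule measurable_subspace_add[OF S v])
  moreover have "F \<in> borel_measurable (restrict_space borel S)"
    using F unfolding measurable_subspace_lborel_eq .
  ultimately have "integral\<^sup>N (distr (subspace_lborel S) (restrict_space borel S) (\<lambda>x. x + v)) F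
      = (\<integral>\<^sup>+x. F (x + v) \<partial>subspace_lborel S)"
    by (simp only: nn_integral_distr measurable_distr_eq1)
  then show ?thesis
    unfolding subspace_lborel_translate[OF S v] by (rule sym)
qed

lemma integral_translate:
  fixes F :: "'a::euclidean_space \<Rightarrow> 'b::{banach, second_countable_topology}"
  assumes S: "subspace S" and v: "v \<in> S" and F: "F \<in> borel_measurable (subspace_lborel S)"
  shows "(\<integral>x. F (x + v) \<partial>subspace_lborel S) = (\<integral>x. F x \<partial>subspace_lborel S)"
proof -
  have "(\<lambda>x. x + v) \<in> measurable (subspace_lborel S) (restrict_space borel S)"
    unfolding measurable_subspace_lborel_eq by (rule measurable_subspace_add[OF S v])
  moreover have "F \<in> borel_measurable (restrict_space borel S)"
    using F unfolding measurable_subspace_lborel_eq .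
  ultimately have "(\<integral>x. F x \<partial>distr (subspace_lborel S) (restrict_space borel S) (\<lambda>x. x + v))
      = (\<integral>x. F (x + v) \<partial>subspace_lborel S)"
    by (rule integral_distr)
  then show ?thesis
    unfolding subspace_lborel_translate[OF S v] by (rule sym)
qed


text \<open>
  Fubini in coordinates: the Gaussian, its Fourier transform and the majorant
  \<open>\<Prod>b. 1 / (1 + (x \<bullet> b)\<^sup>2)\<close> all split into functions of single coordinates.
\<close>
lemma integral_basis_prod:
  fixes S :: "'a::euclidean_space set" and g :: "'a \<Rightarrow> real \<Rightarrow> 'b::{real_normed_field,banach,second_countable_topology}"
  assumes S: "subspace S" and g: "\<And>b. b \<in> coord_basis S \<Longrightarrow> integrable lborel (g b)"
  shows integrable_basis_prod: "integrable (subspace_lborel S) (\<lambda>x. \<Prod>b\<in>coord_basis S. g b (x \<bullet> b))" (is ?I)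
    and "(\<integral>x. (\<Prod>b\<in>coord_basis S. g b (x \<bullet> b)) \<partial>subspace_lborel S) = (\<Prod>b\<in>coord_basis S. integral\<^sup>L lborel (g b))" (is ?E)
proof -
  let ?B = "coord_basis S"
  let ?P = "\<Pi>\<^sub>M b\<in>?B. (lborel :: real measure)" and ?s = "\<lambda>c. \<Sum>b\<in>?B. c b *\<^sub>R b"
  let ?h = "\<lambda>x. \<Prod>b\<in>?B. g b (x \<bullet> b)"
  note B = coord_basis(1,2)[OF S]
  interpret product_sigma_finite "\<lambda>_::'a. lborel :: real measure" ..
  have eq: "?h (?s c) = (\<Prod>b\<in>?B. g b (c b))" for c
    using orthonormal_inner_sum[OF B] by (intro prod.cong) auto
  have "?h \<in> borel_measurable borel"
  proof (intro borel_measurable_prod)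
    fix b assume "b \<in> ?B"
    from borel_measurable_integrable[OF g[OF this]] have "g b \<in> borel_measurable borel" by simp
    then show "(\<lambda>x. g b (x \<bullet> b)) \<in> borel_measurable borel"
      by (rule measurable_compose[rotated]) simp
  qed
  then have h: "?h \<in> borel_measurable (restrict_space borel S)"
    by (rule measurable_restrict_space1)
  note s = measurable_coordinates[OF B]
  show ?I
    unfolding subspace_lborel_coordinates integrable_distr_eq[OF s h] eq
    by (rule product_integrable_prod[OF B(2) g])
  show ?E
    unfolding subspace_lborel_coordinates integral_distr[OF s h] eq
    by (rule product_integral_prod[OF B(2) g])
qed

section \<open>Uniqueness of Lebesgue measure on a subspace\<close>

text \<open>
  The characteristic function of the standard normal distribution, without the normalisation
  of its density.
\<close>
lemma gaussian_fourier_real: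
  shows "integrable lborel (\<lambda>t. exp (- t\<^sup>2 / 2) :: real)"
    and "(\<integral>t. complex_of_real (exp (- t\<^sup>2 / 2)) * exp (\<i> * complex_of_real (t * s)) \<partial>lborel)
      = complex_of_real (sqrt (2 * pi) * exp (- s\<^sup>2 / 2))"
proof -
  have eq: "exp (- t\<^sup>2 / 2) = sqrt (2 * pi) * std_normal_density t" for t
    by (simp add: std_normal_density_def)
  have "integrable lborel (\<lambda>t. sqrt (2 * pi) * std_normal_density t)"
    by (intro integrable_mult_right integrable_normal_density) simp
  then show "integrable lborel (\<lambda>t. exp (- t\<^sup>2 / 2) :: real)"
    by (simp only: eq)
  have "complex_of_real (exp (- s\<^sup>2 / 2)) = (\<integral>t. iexp (s * t) \<partial>std_normal_distribution)"
    using fun_cong[OF char_std_normal_distribution, of s] by (simp add: char_def)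
  also have "\<dots> = (\<integral>t. std_normal_density t *\<^sub>R iexp (s * t) \<partial>lborel)"
    by (subst integral_density) auto
  finally have "complex_of_real (sqrt (2 * pi)) * complex_of_real (exp (- s\<^sup>2 / 2))
      = (\<integral>t. complex_of_real (sqrt (2 * pi)) * (std_normal_density t *\<^sub>R iexp (s * t)) \<partial>lborel)"
    by (simp only: integral_mult_right_zero)
  also have "\<dots> = (\<integral>t. complex_of_real (exp (- t\<^sup>2 / 2)) * exp (\<i> * complex_of_real (t * s)) \<partial>lborel)"
  proof (rule Bochner_Integration.integral_cong[OF refl])
    fix t :: real
    have "complex_of_real (exp (- t\<^sup>2 / 2)) = complex_of_real (sqrt (2 * pi)) * complex_of_real (std_normal_density t)"
      by (simp only: eq of_real_mult)
    then show "complex_of_real (sqrt (2 * pi)) * (std_normal_density t *\<^sub>R iexp (s * t))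
      = complex_of_real (exp (- t\<^sup>2 / 2)) * exp (\<i> * complex_of_real (t * s))"
      by (simp only: scaleR_conv_of_real mult.assoc mult.commute[of t s])
  qed
  finally show "(\<integral>t. complex_of_real (exp (- t\<^sup>2 / 2)) * exp (\<i> * complex_of_real (t * s)) \<partial>lborel)
      = complex_of_real (sqrt (2 * pi) * exp (- s\<^sup>2 / 2))"
    by simp
qed

text \<open>
  Uniqueness of Haar measure in its cheapest form. With an even kernel \<open>G\<close>, moving translations
  between the two variables by Tonelli's theorem gives
  \<open>\<integral>\<integral> F x G y = \<integral>\<integral> F (x + y) G y = \<integral>\<integral> F y G (y - x) = \<integral>\<integral> F y G x\<close>,
  where \<open>x\<close> is integrated by the first measure and \<open>y\<close> by the second; the last step uses that
  \<open>G\<close> is even. The measures enter as images under \<open>\<phi>\<close> and \<open>\<psi>\<close> because an image of a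
  \<open>\<sigma>\<close>-finite measure need not be \<open>\<sigma>\<close>-finite.
\<close>
lemma translation_invariant_unique:
  fixes \<phi> :: "'b \<Rightarrow> 'a::euclidean_space" and \<psi> :: "'c \<Rightarrow> 'a" and F G :: "'a \<Rightarrow> ennreal"
  assumes S: "subspace S"
    and M: "sigma_finite_measure M" and N: "sigma_finite_measure N"
    and \<phi>: "\<phi> \<in> borel_measurable M" "\<And>x. x \<in> space M \<Longrightarrow> \<phi> x \<in> S"
    and \<psi>: "\<psi> \<in> borel_measurable N" "\<And>y. y \<in> space N \<Longrightarrow> \<psi> y \<in> S"
    and invM: "\<And>(F :: 'a \<Rightarrow> ennreal) v. F \<in> borel_measurable borel \<Longrightarrow> v \<in> S \<Longrightarrow>
      (\<integral>\<^sup>+x. F (\<phi> x + v) \<partial>M) = (\<integral>\<^sup>+x. F (\<phi> x) \<partial>M)"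
    and invN: "\<And>(F :: 'a \<Rightarrow> ennreal) v. F \<in> borel_measurable borel \<Longrightarrow> v \<in> S \<Longrightarrow>
      (\<integral>\<^sup>+y. F (\<psi> y + v) \<partial>N) = (\<integral>\<^sup>+y. F (\<psi> y) \<partial>N)"
    and F[measurable]: "F \<in> borel_measurable borel"
    and G[measurable]: "G \<in> borel_measurable borel" and even: "\<And>x. G (- x) = G x"
  shows "(\<integral>\<^sup>+x. F (\<phi> x) \<partial>M) * (\<integral>\<^sup>+y. G (\<psi> y) \<partial>N) = (\<integral>\<^sup>+y. F (\<psi> y) \<partial>N) * (\<integral>\<^sup>+x. G (\<phi> x) \<partial>M)"
proof -
  interpret pair_sigma_finite M N using M N by (simp add: pair_sigma_finite_def)
  note [measurable] = \<phi>(1) \<psi>(1)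
  have "(\<integral>\<^sup>+x. F (\<phi> x) \<partial>M) * (\<integral>\<^sup>+y. G (\<psi> y) \<partial>N) = (\<integral>\<^sup>+y. (\<integral>\<^sup>+x. F (\<phi> x) * G (\<psi> y) \<partial>M) \<partial>N)"
    by (simp add: nn_integral_multc nn_integral_cmult)
  also have "\<dots> = (\<integral>\<^sup>+y. (\<integral>\<^sup>+x. F (\<phi> x + \<psi> y) * G (\<psi> y) \<partial>M) \<partial>N)"
    by (rule nn_integral_cong) (simp add: nn_integral_multc invM \<psi>(2))
  also have "\<dots> = (\<integral>\<^sup>+x. (\<integral>\<^sup>+y. F (\<phi> x + \<psi> y) * G (\<psi> y) \<partial>N) \<partial>M)"
    by (rule Fubini') measurable
  also have "\<dots> = (\<integral>\<^sup>+x. (\<integral>\<^sup>+y. F (\<psi> y) * G (\<psi> y - \<phi> x) \<partial>N) \<partial>M)"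
  proof (rule nn_integral_cong)
    fix x assume "x \<in> space M"
    with invN[of "\<lambda>w. F w * G (w - \<phi> x)" "\<phi> x"]
    show "(\<integral>\<^sup>+y. F (\<phi> x + \<psi> y) * G (\<psi> y) \<partial>N) = (\<integral>\<^sup>+y. F (\<psi> y) * G (\<psi> y - \<phi> x) \<partial>N)"
      by (simp add: \<phi>(2) add.commute)
  qed
  also have "\<dots> = (\<integral>\<^sup>+y. (\<integral>\<^sup>+x. F (\<psi> y) * G (\<psi> y - \<phi> x) \<partial>M) \<partial>N)"
    by (rule Fubini'[symmetric]) measurable
  also have "\<dots> = (\<integral>\<^sup>+y. F (\<psi> y) * (\<integral>\<^sup>+x. G (\<phi> x) \<partial>M) \<partial>N)"
  proof (rule nn_integral_cong)
    fix y assume "y \<in> space N"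
    then have "- \<psi> y \<in> S" using \<psi>(2) S by (simp add: subspace_neg)
    then have "(\<integral>\<^sup>+x. G (\<phi> x - \<psi> y) \<partial>M) = (\<integral>\<^sup>+x. G (\<phi> x) \<partial>M)"
      using invM[OF G, of "- \<psi> y"] by simp
    moreover have "G (\<psi> y - \<phi> x) = G (\<phi> x - \<psi> y)" for x
      using even[of "\<psi> y - \<phi> x"] by simp
    ultimately show "(\<integral>\<^sup>+x. F (\<psi> y) * G (\<psi> y - \<phi> x) \<partial>M) = F (\<psi> y) * (\<integral>\<^sup>+x. G (\<phi> x) \<partial>M)"
      by (simp add: nn_integral_cmult)
  qed
  also have "\<dots> = (\<integral>\<^sup>+y. F (\<psi> y) \<partial>N) * (\<integral>\<^sup>+x. G (\<phi> x) \<partial>M)"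
    by (simp add: nn_integral_multc)
  finally show ?thesis .
qed

text \<open>
  The kernel for which both the uniqueness argument and the regularisation of the Fourier
  integral are computed: it is even, strictly positive, and a product in every orthonormal basis.
\<close>
definition gauss :: "'a::euclidean_space \<Rightarrow> real" where
  "gauss x = exp (- (norm x)\<^sup>2 / 2)"

lemma continuous_gauss: "continuous_on A gauss"
  unfolding gauss_def by (intro continuous_intros) auto

lemma borel_measurable_gauss [measurable]: "gauss \<in> borel_measurable borel"
  by (intro borel_measurable_continuous_onI continuous_gauss)

lemma gauss_pos: "0 < gauss x" and gauss_le_1: "gauss x \<le> 1"
  by (auto simp: gauss_def)

lemma abs_gauss [simp]: "\<bar>gauss x\<bar> = gauss x"
  using gauss_pos[of x] by simp

lemma gauss_basis_prod:
  assumes "subspace S" "x \<in> S"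
  shows "gauss x = (\<Prod>b\<in>coord_basis S. exp (- (x \<bullet> b)\<^sup>2 / 2))"
proof -
  note B = coord_basis(1,2)[OF assms(1)]
  have "(norm x)\<^sup>2 = (\<Sum>b\<in>coord_basis S. (x \<bullet> b)\<^sup>2)"
    using orthonormal_norm_sum[OF B, of "\<lambda>b. x \<bullet> b"] orthonormal_expansion[OF B assms(2)] by simp
  then show ?thesis
    by (simp add: gauss_def sum_negf sum_divide_distrib flip: exp_sum[OF B(2)])
qed

lemma integrable_gauss_scaled:
  fixes e :: real and S :: "'a::euclidean_space set"
  assumes S: "subspace S" and e: "e > 0"
  shows "integrable (subspace_lborel S) (\<lambda>x. gauss (e *\<^sub>R x))"
    and "(\<integral>x. gauss (e *\<^sub>R x) \<partial>subspace_lborel S) = (sqrt (2 * pi) / e) ^ dim S"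
proof -
  let ?g = "\<lambda>t. exp (- (e * t)\<^sup>2 / 2) :: real"
  have eq: "gauss (e *\<^sub>R x) = (\<Prod>b\<in>coord_basis S. ?g (x \<bullet> b))" if "x \<in> S" for x
    using gauss_basis_prod[OF S, of "e *\<^sub>R x"] subspace_scale[OF S that] by simp
  have 1: "integrable lborel ?g"
    using lborel_integrable_real_affine[OF gaussian_fourier_real(1), of e 0] e by simp
  have 0: "(\<integral>t. exp (- t\<^sup>2 / 2) \<partial>lborel) = sqrt (2 * pi)"
  proof -
    have "complex_of_real (\<integral>t. exp (- t\<^sup>2 / 2) \<partial>lborel) = complex_of_real (sqrt (2 * pi))"
      using gaussian_fourier_real(2)[of 0] unfolding integral_complex_of_real[symmetric] by simp
    then show ?thesis by (simp only: of_real_eq_iff)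
  qed
  have 2: "integral\<^sup>L lborel ?g = sqrt (2 * pi) / e"
    using lborel_integral_real_affine[of e "\<lambda>t. exp (- t\<^sup>2 / 2)" 0] e 0 by (simp add: field_simps)
  have "integrable (subspace_lborel S) (\<lambda>x. \<Prod>b\<in>coord_basis S. ?g (x \<bullet> b))"
    by (rule integrable_basis_prod[OF S 1])
  then show "integrable (subspace_lborel S) (\<lambda>x. gauss (e *\<^sub>R x))"
    by (subst Bochner_Integration.integrable_cong[OF refl eq]) auto
  have "(\<integral>x. gauss (e *\<^sub>R x) \<partial>subspace_lborel S) = (\<integral>x. (\<Prod>b\<in>coord_basis S. ?g (x \<bullet> b)) \<partial>subspace_lborel S)"
    by (rule Bochner_Integration.integral_cong[OF refl eq]) simp
  also have "\<dots> = (sqrt (2 * pi) / e) ^ dim S"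
    unfolding integral_basis_prod(2)[OF S 1] 2 by (simp add: coord_basis(3)[OF S])
  finally show "(\<integral>x. gauss (e *\<^sub>R x) \<partial>subspace_lborel S) = (sqrt (2 * pi) / e) ^ dim S" .
qed

lemma nn_integral_gauss_scaled:
  fixes e :: real and S :: "'a::euclidean_space set"
  assumes S: "subspace S" and e: "e > 0"
  shows "(\<integral>\<^sup>+x. ennreal (gauss (e *\<^sub>R x)) \<partial>subspace_lborel S) = ennreal ((sqrt (2 * pi) / e) ^ dim S)"
  unfolding integrable_gauss_scaled(2)[OF assms, symmetric]
  by (rule nn_integral_eq_integral[OF integrable_gauss_scaled(1)[OF assms]])
    (simp add: gauss_pos less_imp_le)

text \<open>
  The Gaussian is strictly positive with finite integral, so its superlevel sets have finite
  measure and exhaust \<open>S\<close>.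
\<close>
lemma sigma_finite_subspace_lborel:
  assumes S: "subspace S"
  shows "sigma_finite_measure (subspace_lborel S)"
proof
  let ?L = "subspace_lborel S"
  let ?A = "\<lambda>n::nat. {x\<in>S. gauss x \<ge> 1 / real (Suc n)}"
  have g: "(\<integral>\<^sup>+x. ennreal (gauss x) \<partial>?L) < \<infinity>"
    using nn_integral_gauss_scaled[OF S, of 1] by simp
  have meas: "?A n \<in> sets ?L" for n
    using borel_measurable_subspace_lborel[OF borel_measurable_gauss, of S]
    by (simp add: borel_measurable_iff_ge)
  have fin: "emeasure ?L (?A n) \<noteq> \<infinity>" for n
  proof -
    have "emeasure ?L (?A n) = (\<integral>\<^sup>+x. indicator (?A n) x \<partial>?L)"
      using meas by simp
    also have "\<dots> \<le> (\<integral>\<^sup>+x. ennreal (Suc n) * ennreal (gauss x) \<partial>?L)"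
    proof (rule nn_integral_mono)
      fix x
      show "indicator (?A n) x \<le> ennreal (Suc n) * ennreal (gauss x)"
      proof (cases "x \<in> ?A n")
        case True
        then have "1 \<le> real (Suc n) * gauss x" by (simp add: field_simps)
        then have "ennreal 1 \<le> ennreal (real (Suc n) * gauss x)" by (rule ennreal_leI)
        with True show ?thesis by (simp add: ennreal_mult gauss_pos less_imp_le)
      qed simp
    qed
    also have "\<dots> = ennreal (Suc n) * (\<integral>\<^sup>+x. ennreal (gauss x) \<partial>?L)"
      by (rule nn_integral_cmult) (intro borel_measurable_subspace_lborel, measurable)
    also have "\<dots> < \<infinity>" using g by (simp add: ennreal_mult_less_top)
    finally show ?thesis by simp
  qed
  have "\<exists>n. gauss x \<ge> 1 / real (Suc n)" for x :: 'a
    using reals_Archimedean[OF gauss_pos[of x]] by (auto simp: inverse_eq_divide intro: less_imp_le)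
  then have "(\<Union>n. ?A n) = S" by auto
  then show "\<exists>A. countable A \<and> A \<subseteq> sets ?L \<and> \<Union> A = space ?L \<and> (\<forall>a\<in>A. emeasure ?L a \<noteq> \<infinity>)"
    using meas fin by (intro exI[of _ "range ?A"]) auto
qed

text \<open>
  Lebesgue measure on \<open>S\<close> is recognised, up to the factor \<open>r\<close>, by translation invariance and
  the mass of the Gaussian. This takes the place of a change of variables: orthogonal
  decomposition and dilation each reduce to evaluating one Gaussian integral.
\<close>
lemma subspace_lborel_eqI:
  fixes S :: "'a::euclidean_space set" and \<phi> :: "'b \<Rightarrow> 'a"
  assumes S: "subspace S" and M: "sigma_finite_measure M"
    and \<phi>: "\<phi> \<in> measurable M (restrict_space borel S)"
    and inv: "\<And>(F :: 'a \<Rightarrow> ennreal) v. F \<in> borel_measurable borel \<Longrightarrow> v \<in> S \<Longrightarrow>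
      (\<integral>\<^sup>+x. F (\<phi> x + v) \<partial>M) = (\<integral>\<^sup>+x. F (\<phi> x) \<partial>M)"
    and mass: "(\<integral>\<^sup>+x. ennreal (gauss (\<phi> x)) \<partial>M) = ennreal (r * sqrt (2 * pi) ^ dim S)" and r: "r \<ge> 0"
  shows "distr M (restrict_space borel S) \<phi> = density (subspace_lborel S) (\<lambda>_. ennreal r)"
proof (rule measure_eqI)
  let ?L = "subspace_lborel S"
  have \<phi>': "\<phi> \<in> borel_measurable M" "\<And>x. x \<in> space M \<Longrightarrow> \<phi> x \<in> S"
    using \<phi> unfolding measurable_restrict_space2_iff by auto
  fix A assume "A \<in> sets (distr M (restrict_space borel S) \<phi>)"
  then have A: "A \<in> sets (restrict_space borel S)" by simp
  then have A': "A \<in> sets borel"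
    using S by (simp add: sets_restrict_space_iff closed_subspace borel_closed)
  have "(\<integral>\<^sup>+x. indicator A (\<phi> x) \<partial>M) * (\<integral>\<^sup>+x. ennreal (gauss x) \<partial>?L)
      = (\<integral>\<^sup>+x. indicator A x \<partial>?L) * (\<integral>\<^sup>+x. ennreal (gauss (\<phi> x)) \<partial>M)"
  proof (rule translation_invariant_unique[OF S M sigma_finite_subspace_lborel[OF S] \<phi>'])
    show "(\<lambda>x. x) \<in> borel_measurable ?L" by (rule measurable_subspace_lborel_ident)
    show "(\<integral>\<^sup>+y. F (y + v) \<partial>?L) = (\<integral>\<^sup>+y. F y \<partial>?L)"
      if "F \<in> borel_measurable borel" "v \<in> S" for F :: "'a \<Rightarrow> ennreal" and v
      using that by (intro nn_integral_translate S borel_measurable_subspace_lborel)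
  qed (use inv A' in \<open>auto simp: gauss_def\<close>)
  moreover have "(\<integral>\<^sup>+x. indicator A x \<partial>?L) = emeasure ?L A"
    using A by (simp add: sets_subspace_lborel)
  moreover have "(\<integral>\<^sup>+x. indicator A (\<phi> x) \<partial>M) = emeasure (distr M (restrict_space borel S) \<phi>) A"
    using nn_integral_distr[OF \<phi>, of "indicator A"] A by simp
  moreover have "(\<integral>\<^sup>+x. ennreal (gauss x) \<partial>?L) = ennreal (sqrt (2 * pi) ^ dim S)"
    using nn_integral_gauss_scaled[OF S, of 1] by simp
  ultimately have "emeasure (distr M (restrict_space borel S) \<phi>) A * ennreal (sqrt (2 * pi) ^ dim S)
      = emeasure ?L A * ennreal r * ennreal (sqrt (2 * pi) ^ dim S)"
    using r by (simp add: mass ennreal_mult mult_ac)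
  then have "emeasure (distr M (restrict_space borel S) \<phi>) A = emeasure ?L A * ennreal r"
    by (simp add: ennreal_mult_cancel_left mult.commute[of _ "ennreal (_ ^ _)"])
  then show "emeasure (distr M (restrict_space borel S) \<phi>) A = emeasure (density ?L (\<lambda>_. ennreal r)) A"
    using A by (simp add: emeasure_density_const sets_subspace_lborel mult.commute)
qed (simp add: sets_subspace_lborel)

section \<open>Orthogonal sums, dilations and Gaussian integrals\<close>

lemma measurable_pair_subspace_lborel [measurable]:
  "fst \<in> borel_measurable (subspace_lborel S \<Otimes>\<^sub>M N)" "snd \<in> borel_measurable (N \<Otimes>\<^sub>M subspace_lborel S)"
  using measurable_compose[OF measurable_fst measurable_subspace_lborel_ident]
    measurable_compose[OF measurable_snd measurable_subspace_lborel_ident] by auto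

lemma pair_sigma_finite_subspace_lborel:
  "subspace S \<Longrightarrow> subspace T \<Longrightarrow> pair_sigma_finite (subspace_lborel S) (subspace_lborel T)"
  by (simp add: pair_sigma_finite_def sigma_finite_subspace_lborel)

lemma measurable_add_subspace_lborel:
  assumes "subspace H1" "subspace H2"
  shows "(\<lambda>(x, y). x + y) \<in> measurable (subspace_lborel H1 \<Otimes>\<^sub>M subspace_lborel H2) (restrict_space borel (span (H1 \<union> H2)))"
proof (rule measurable_restrict_space2)
  show "(\<lambda>(x, y). x + y) \<in> space (subspace_lborel H1 \<Otimes>\<^sub>M subspace_lborel H2) \<rightarrow> span (H1 \<union> H2)"
    by (auto simp: space_pair_measure intro: span_add span_base)
  show "(\<lambda>(x, y). x + y) \<in> borel_measurable (subspace_lborel H1 \<Otimes>\<^sub>M subspace_lborel H2)"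
    unfolding case_prod_beta by (intro borel_measurable_add measurable_pair_subspace_lborel)
qed

text \<open>
  The image of the product measure under addition is invariant under \<open>H1\<close> and under \<open>H2\<close>, and
  the Gaussian of an orthogonal sum is the product of the Gaussians.
\<close>
theorem subspace_lborel_orthogonal_sum:
  fixes H1 H2 :: "'a::euclidean_space set"
  assumes H1: "subspace H1" and H2: "subspace H2"
    and orth: "\<And>x y. x \<in> H1 \<Longrightarrow> y \<in> H2 \<Longrightarrow> x \<bullet> y = 0"
  shows "distr (subspace_lborel H1 \<Otimes>\<^sub>M subspace_lborel H2) (restrict_space borel (span (H1 \<union> H2))) (\<lambda>(x, y). x + y)
    = subspace_lborel (span (H1 \<union> H2))"
proof -
  let ?L1 = "subspace_lborel H1" and ?L2 = "subspace_lborel H2" and ?S = "span (H1 \<union> H2)"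
  interpret pair_sigma_finite ?L1 ?L2 by (rule pair_sigma_finite_subspace_lborel[OF H1 H2])
  have "distr (?L1 \<Otimes>\<^sub>M ?L2) (restrict_space borel ?S) (\<lambda>(x, y). x + y) = density (subspace_lborel ?S) (\<lambda>_. ennreal 1)"
  proof (rule subspace_lborel_eqI)
    show "sigma_finite_measure (?L1 \<Otimes>\<^sub>M ?L2)" ..
    show "(\<lambda>(x, y). x + y) \<in> measurable (?L1 \<Otimes>\<^sub>M ?L2) (restrict_space borel ?S)"
      by (rule measurable_add_subspace_lborel[OF H1 H2])
    fix F :: "'a \<Rightarrow> ennreal" and v
    assume F[measurable]: "F \<in> borel_measurable borel" and "v \<in> ?S"
    then obtain v1 v2 where v: "v1 \<in> H1" "v2 \<in> H2" "v = v1 + v2"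
      using H1 H2 by (auto simp: span_Un span_eq_iff[THEN iffD2])
    have "(\<integral>\<^sup>+p. F ((case p of (x, y) \<Rightarrow> x + y) + v) \<partial>(?L1 \<Otimes>\<^sub>M ?L2)) = (\<integral>\<^sup>+x. \<integral>\<^sup>+y. F (x + y + v) \<partial>?L2 \<partial>?L1)"
      by (subst M2.nn_integral_fst[symmetric]) (auto simp: case_prod_beta)
    also have "\<dots> = (\<integral>\<^sup>+x. \<integral>\<^sup>+y. F (x + y + v1) \<partial>?L2 \<partial>?L1)"
    proof (rule nn_integral_cong)
      fix x
      show "(\<integral>\<^sup>+y. F (x + y + v) \<partial>?L2) = (\<integral>\<^sup>+y. F (x + y + v1) \<partial>?L2)"
        using nn_integral_translate[OF H2 v(2), of "\<lambda>y. F (x + y + v1)"]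
        by (simp add: v(3) ac_simps borel_measurable_subspace_lborel)
    qed
    also have "\<dots> = (\<integral>\<^sup>+y. \<integral>\<^sup>+x. F (x + y + v1) \<partial>?L1 \<partial>?L2)"
      by (rule Fubini'[symmetric]) (auto simp: case_prod_beta)
    also have "\<dots> = (\<integral>\<^sup>+y. \<integral>\<^sup>+x. F (x + y) \<partial>?L1 \<partial>?L2)"
    proof (rule nn_integral_cong)
      fix y
      show "(\<integral>\<^sup>+x. F (x + y + v1) \<partial>?L1) = (\<integral>\<^sup>+x. F (x + y) \<partial>?L1)"
        using nn_integral_translate[OF H1 v(1), of "\<lambda>x. F (x + y)"]
        by (simp add: ac_simps borel_measurable_subspace_lborel)
    qed
    also have "\<dots> = (\<integral>\<^sup>+x. \<integral>\<^sup>+y. F (x + y) \<partial>?L2 \<partial>?L1)"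
      by (rule Fubini') (auto simp: case_prod_beta)
    also have "\<dots> = (\<integral>\<^sup>+p. F (case p of (x, y) \<Rightarrow> x + y) \<partial>(?L1 \<Otimes>\<^sub>M ?L2))"
      by (subst M2.nn_integral_fst[symmetric]) (auto simp: case_prod_beta)
    finally show "(\<integral>\<^sup>+p. F ((case p of (x, y) \<Rightarrow> x + y) + v) \<partial>(?L1 \<Otimes>\<^sub>M ?L2))
      = (\<integral>\<^sup>+p. F (case p of (x, y) \<Rightarrow> x + y) \<partial>(?L1 \<Otimes>\<^sub>M ?L2))" .
  next
    have g: "gauss (x + y) = gauss x * gauss y" if "x \<in> H1" "y \<in> H2" for x y
      using orth[OF that] by (simp add: gauss_def power2_norm_eq_inner inner_add_left inner_add_right inner_commute
          add_divide_distrib diff_divide_distrib flip: exp_add)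
    have "(\<integral>\<^sup>+p. ennreal (gauss (case p of (x, y) \<Rightarrow> x + y)) \<partial>(?L1 \<Otimes>\<^sub>M ?L2))
        = (\<integral>\<^sup>+x. \<integral>\<^sup>+y. ennreal (gauss (x + y)) \<partial>?L2 \<partial>?L1)"
      by (subst M2.nn_integral_fst[symmetric]) (auto simp: case_prod_beta)
    also have "\<dots> = (\<integral>\<^sup>+x. \<integral>\<^sup>+y. ennreal (gauss x) * ennreal (gauss y) \<partial>?L2 \<partial>?L1)"
      by (intro nn_integral_cong) (simp add: g ennreal_mult gauss_pos less_imp_le)
    also have "\<dots> = (\<integral>\<^sup>+x. ennreal (gauss x) * (\<integral>\<^sup>+y. ennreal (gauss y) \<partial>?L2) \<partial>?L1)"
      by (intro nn_integral_cong nn_integral_cmult borel_measurable_subspace_lborel) measurable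
    also have "\<dots> = (\<integral>\<^sup>+x. ennreal (gauss x) \<partial>?L1) * (\<integral>\<^sup>+y. ennreal (gauss y) \<partial>?L2)"
      by (intro nn_integral_multc borel_measurable_subspace_lborel) measurable
    also have "\<dots> = ennreal (1 * sqrt (2 * pi) ^ dim ?S)"
      using nn_integral_gauss_scaled[OF H1, of 1] nn_integral_gauss_scaled[OF H2, of 1] dim_orthogonal_sum[OF orth]
      by (simp add: power_add ennreal_mult)
    finally show "(\<integral>\<^sup>+p. ennreal (gauss (case p of (x, y) \<Rightarrow> x + y)) \<partial>(?L1 \<Otimes>\<^sub>M ?L2)) = ennreal (1 * sqrt (2 * pi) ^ dim ?S)" .
  qed auto
  then show ?thesis by (simp add: density_1)
qed

lemma integral_orthogonal_sum:
  fixes h :: "'a::euclidean_space \<Rightarrow> 'b::{banach, second_countable_topology}"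
  assumes H1: "subspace H1" and H2: "subspace H2"
    and orth: "\<And>x y. x \<in> H1 \<Longrightarrow> y \<in> H2 \<Longrightarrow> x \<bullet> y = 0"
    and h: "h \<in> borel_measurable borel"
  shows "integrable (subspace_lborel (span (H1 \<union> H2))) h \<longleftrightarrow>
      integrable (subspace_lborel H1 \<Otimes>\<^sub>M subspace_lborel H2) (\<lambda>(x, y). h (x + y))"
    and "(\<integral>x. h x \<partial>subspace_lborel (span (H1 \<union> H2))) =
      (\<integral>(x, y). h (x + y) \<partial>(subspace_lborel H1 \<Otimes>\<^sub>M subspace_lborel H2))"
proof -
  note add = measurable_add_subspace_lborel[OF H1 H2] and h' = measurable_restrict_space1[OF h, of "span (H1 \<union> H2)"]
  have eq: "distr (subspace_lborel H1 \<Otimes>\<^sub>M subspace_lborel H2) (restrict_space borel (span (H1 \<union> H2))) (\<lambda>(x, y). x + y)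
    = subspace_lborel (span (H1 \<union> H2))"
    using orth by (intro subspace_lborel_orthogonal_sum[OF H1 H2])
  show "integrable (subspace_lborel (span (H1 \<union> H2))) h \<longleftrightarrow>
      integrable (subspace_lborel H1 \<Otimes>\<^sub>M subspace_lborel H2) (\<lambda>(x, y). h (x + y))"
    by (subst eq[symmetric], subst integrable_distr_eq[OF add h']) (simp add: case_prod_unfold)
  show "(\<integral>x. h x \<partial>subspace_lborel (span (H1 \<union> H2))) =
      (\<integral>(x, y). h (x + y) \<partial>(subspace_lborel H1 \<Otimes>\<^sub>M subspace_lborel H2))"
    by (subst eq[symmetric], subst integral_distr[OF add h']) (simp add: case_prod_unfold)
qed

text \<open>
  The dilated measure is again translation invariant, so only its constant has to be found.
\<close>
lemma integral_scaled:
  fixes h :: "'a::euclidean_space \<Rightarrow> 'b::{banach, second_countable_topology}"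
  assumes S: "subspace S" and e: "e > 0" and h: "h \<in> borel_measurable borel"
  shows "(\<integral>x. h (e *\<^sub>R x) \<partial>subspace_lborel S) = (1 / e ^ dim S) *\<^sub>R (\<integral>x. h x \<partial>subspace_lborel S)"
proof -
  let ?L = "subspace_lborel S"
  have scale: "(\<lambda>x. e *\<^sub>R x) \<in> measurable ?L (restrict_space borel S)"
  proof (rule measurable_restrict_space2)
    show "(\<lambda>x. e *\<^sub>R x) \<in> space ?L \<rightarrow> S" using S by (auto intro: subspace_scale)
  qed (intro borel_measurable_subspace_lborel, measurable)
  have eq: "distr ?L (restrict_space borel S) (\<lambda>x. e *\<^sub>R x) = density ?L (\<lambda>_. ennreal (1 / e ^ dim S))"
  proof (rule subspace_lborel_eqI[OF S sigma_finite_subspace_lborel[OF S] scale])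
    fix F :: "'a \<Rightarrow> ennreal" and v assume "F \<in> borel_measurable borel" "v \<in> S"
    then show "(\<integral>\<^sup>+x. F (e *\<^sub>R x + v) \<partial>?L) = (\<integral>\<^sup>+x. F (e *\<^sub>R x) \<partial>?L)"
      using nn_integral_translate[OF S subspace_scale[OF S, of v "1 / e"], of "\<lambda>x. F (e *\<^sub>R x)"] e
      by (simp add: scaleR_add_right borel_measurable_subspace_lborel)
  next
    show "(\<integral>\<^sup>+x. ennreal (gauss (e *\<^sub>R x)) \<partial>?L) = ennreal (1 / e ^ dim S * sqrt (2 * pi) ^ dim S)"
      by (simp add: nn_integral_gauss_scaled[OF S e] power_divide)
  qed (use e in simp)
  have h': "h \<in> borel_measurable (restrict_space borel S)" by (rule measurable_restrict_space1[OF h])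
  have "(\<integral>x. h (e *\<^sub>R x) \<partial>?L) = (\<integral>x. h x \<partial>density ?L (\<lambda>_. ennreal (1 / e ^ dim S)))"
    unfolding eq[symmetric] by (rule integral_distr[OF scale h', symmetric])
  also have "\<dots> = (\<integral>x. (1 / e ^ dim S) *\<^sub>R h x \<partial>?L)"
    using e by (intro integral_density borel_measurable_subspace_lborel[OF h]) auto
  finally show ?thesis by simp
qed

text \<open>
  The Gaussian is an eigenfunction of the Fourier transform on \<open>S\<close>, and the character
  \<open>x \<mapsto> exp (i x \<bullet> y)\<close> sees only the projection of \<open>y\<close> to \<open>S\<close>.
\<close>
lemma gaussian_fourier:
  fixes S :: "'a::euclidean_space set"
  assumes S: "subspace S" and e: "e > 0"
  shows "(\<integral>x. complex_of_real (gauss (e *\<^sub>R x)) * exp (\<i> * complex_of_real (x \<bullet> y)) \<partial>subspace_lborel S)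
    = complex_of_real ((sqrt (2 * pi) / e) ^ dim S * gauss ((1 / e) *\<^sub>R orthogonal_proj S y))"
proof -
  let ?L = "subspace_lborel S" and ?B = "coord_basis S"
  note B = coord_basis(1,2)[OF S]
  have unit: "(\<integral>x. complex_of_real (gauss x) * exp (\<i> * complex_of_real (x \<bullet> y)) \<partial>?L)
      = complex_of_real (sqrt (2 * pi) ^ dim S * gauss y)" if y: "y \<in> S" for y
  proof -
    let ?g = "\<lambda>b t. complex_of_real (exp (- t\<^sup>2 / 2)) * exp (\<i> * complex_of_real (t * (y \<bullet> b)))"
    have int: "integrable lborel (?g b)" for b
    proof (rule Bochner_Integration.integrable_bound[OF gaussian_fourier_real(1)])
      show "?g b \<in> borel_measurable lborel" by measurable
    qed (simp add: norm_mult)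
    have "complex_of_real (gauss x) * exp (\<i> * complex_of_real (x \<bullet> y)) = (\<Prod>b\<in>?B. ?g b (x \<bullet> b))" if x: "x \<in> S" for x
    proof -
      have "x \<bullet> y = (\<Sum>b\<in>?B. (x \<bullet> b) * (y \<bullet> b))"
        using arg_cong[OF orthonormal_expansion[OF B y], of "\<lambda>z. x \<bullet> z"]
        by (simp add: inner_sum_right mult.commute)
      then have "\<i> * complex_of_real (x \<bullet> y) = (\<Sum>b\<in>?B. \<i> * complex_of_real ((x \<bullet> b) * (y \<bullet> b)))"
        by (simp add: sum_distrib_left)
      then have "exp (\<i> * complex_of_real (x \<bullet> y)) = (\<Prod>b\<in>?B. exp (\<i> * complex_of_real ((x \<bullet> b) * (y \<bullet> b))))"
        by (simp only: exp_sum[OF B(2)])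
      then show ?thesis
        by (simp only: gauss_basis_prod[OF S x] of_real_prod prod.distrib)
    qed
    then have "(\<integral>x. complex_of_real (gauss x) * exp (\<i> * complex_of_real (x \<bullet> y)) \<partial>?L) = (\<integral>x. (\<Prod>b\<in>?B. ?g b (x \<bullet> b)) \<partial>?L)"
      by (intro Bochner_Integration.integral_cong refl) simp
    also have "\<dots> = (\<Prod>b\<in>?B. complex_of_real (sqrt (2 * pi) * exp (- (y \<bullet> b)\<^sup>2 / 2)))"
      unfolding integral_basis_prod(2)[OF S int] gaussian_fourier_real(2) ..
    also have "\<dots> = complex_of_real (sqrt (2 * pi) ^ dim S * gauss y)"
      unfolding of_real_prod[symmetric] gauss_basis_prod[OF S y] prod.distrib
      by (simp add: coord_basis(3)[OF S])
    finally show ?thesis .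
  qed
  let ?y = "(1 / e) *\<^sub>R orthogonal_proj S y"
  have y: "?y \<in> S" by (intro subspace_scale[OF S] orthogonal_proj_in[OF S])
  let ?h = "\<lambda>x. complex_of_real (gauss x) * exp (\<i> * complex_of_real (x \<bullet> ?y))"
  have "(\<integral>x. complex_of_real (gauss (e *\<^sub>R x)) * exp (\<i> * complex_of_real (x \<bullet> y)) \<partial>?L)
      = (\<integral>x. ?h (e *\<^sub>R x) \<partial>?L)"
  proof (rule Bochner_Integration.integral_cong[OF refl])
    fix x assume "x \<in> space ?L"
    then have "x \<bullet> orthogonal_proj S y = x \<bullet> y"
      using inner_orthogonal_proj[OF S, of x y] by (simp add: inner_commute)
    then show "complex_of_real (gauss (e *\<^sub>R x)) * exp (\<i> * complex_of_real (x \<bullet> y)) = ?h (e *\<^sub>R x)"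
      using e by simp
  qed
  also have "\<dots> = (1 / e ^ dim S) *\<^sub>R (\<integral>x. ?h x \<partial>?L)"
    by (rule integral_scaled[OF S e]) measurable
  also have "\<dots> = complex_of_real ((sqrt (2 * pi) / e) ^ dim S * gauss ?y)"
    unfolding unit[OF y] by (simp add: scaleR_conv_of_real power_divide)
  finally show ?thesis .
qed

lemma integrable_inverse_quadratic: "integrable lborel (\<lambda>t::real. inverse (1 + t\<^sup>2))"
  using integrable_inverse_1_plus_square by (simp add: set_integrable_def)

text \<open>
  Each factor \<open>1 + (x \<bullet> b)\<^sup>2\<close> is at most \<open>1 + (norm x)\<^sup>2\<close>, so the function is dominated by the
  product of the integrable functions \<open>1 / (1 + t\<^sup>2)\<close> of the coordinates.
\<close>
lemma integrable_polynomial_decay: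
  fixes S :: "'a::euclidean_space set"
  assumes S: "subspace S" and p: "dim S \<le> p"
  shows "integrable (subspace_lborel S) (\<lambda>x. 1 / (1 + (norm x)\<^sup>2) ^ p)"
proof (rule Bochner_Integration.integrable_bound)
  let ?B = "coord_basis S"
  note B = coord_basis(1,2,3)[OF S]
  show "integrable (subspace_lborel S) (\<lambda>x. \<Prod>b\<in>?B. inverse (1 + (x \<bullet> b)\<^sup>2))"
    by (rule integrable_basis_prod[OF S integrable_inverse_quadratic])
  show "(\<lambda>x. 1 / (1 + (norm x)\<^sup>2) ^ p) \<in> borel_measurable (subspace_lborel S)"
    by (intro borel_measurable_subspace_lborel) measurable
  have "norm (1 / (1 + (norm x)\<^sup>2) ^ p) \<le> norm (\<Prod>b\<in>?B. inverse (1 + (x \<bullet> b)\<^sup>2))" for x :: 'a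
  proof -
    have "(\<Prod>b\<in>?B. 1 + (x \<bullet> b)\<^sup>2) \<le> (\<Prod>b\<in>?B. 1 + (norm x)\<^sup>2)"
    proof (intro prod_mono conjI)
      fix b assume "b \<in> ?B"
      then have "norm b = 1" using B(1) by (simp add: orthonormal_basis_def)
      then have "\<bar>x \<bullet> b\<bar> \<le> norm x" using Cauchy_Schwarz_ineq2[of x b] by simp
      then show "1 + (x \<bullet> b)\<^sup>2 \<le> 1 + (norm x)\<^sup>2" using power_mono[of "\<bar>x \<bullet> b\<bar>" "norm x" 2] by simp
    qed simp
    also have "\<dots> \<le> (1 + (norm x)\<^sup>2) ^ p"
      using p by (simp add: B(3) power_increasing)
    finally have "(\<Prod>b\<in>?B. 1 + (x \<bullet> b)\<^sup>2) \<le> (1 + (norm x)\<^sup>2) ^ p" .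
    moreover have "(\<Prod>b\<in>?B. 1 + (x \<bullet> b)\<^sup>2) > 0" by (intro prod_pos) (simp add: add_pos_nonneg)
    ultimately have "1 / (1 + (norm x)\<^sup>2) ^ p \<le> 1 / (\<Prod>b\<in>?B. 1 + (x \<bullet> b)\<^sup>2)"
      by (intro divide_left_mono) (auto intro!: mult_pos_pos add_pos_nonneg zero_less_power)
    also have "\<dots> = (\<Prod>b\<in>?B. inverse (1 + (x \<bullet> b)\<^sup>2))"
      by (simp add: prod_dividef inverse_eq_divide)
    finally show ?thesis by (simp add: add_nonneg_nonneg)
  qed
  then show "AE x in subspace_lborel S. norm (1 / (1 + (norm x)\<^sup>2) ^ p) \<le> norm (\<Prod>b\<in>?B. inverse (1 + (x \<bullet> b)\<^sup>2))"
    by simp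
qed

section \<open>Fourier transforms of Schwartz functions\<close>

lemma integrable_of_decay:
  fixes h :: "'a::euclidean_space \<Rightarrow> 'b::{banach, second_countable_topology}"
  assumes S: "subspace S" and p: "dim S \<le> p" and h: "h \<in> borel_measurable (subspace_lborel S)"
    and bound: "\<And>x. x \<in> S \<Longrightarrow> norm (h x) \<le> C / (1 + (norm x)\<^sup>2) ^ p"
  shows "integrable (subspace_lborel S) h"
proof (rule Bochner_Integration.integrable_bound)
  show "integrable (subspace_lborel S) (\<lambda>x. C * (1 / (1 + (norm x)\<^sup>2) ^ p))"
    by (intro integrable_mult_right integrable_polynomial_decay[OF S p])
  show "AE x in subspace_lborel S. norm (h x) \<le> norm (C * (1 / (1 + (norm x)\<^sup>2) ^ p))"
  proof (rule AE_I2)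
    fix x assume "x \<in> space (subspace_lborel S)"
    then have "norm (h x) \<le> C * (1 / (1 + (norm x)\<^sup>2) ^ p)" using bound[of x] by simp
    then show "norm (h x) \<le> norm (C * (1 / (1 + (norm x)\<^sup>2) ^ p))" by (rule order_trans) (simp only: real_norm_def abs_ge_self)
  qed
qed (rule h)

lemma schwartz_dir_deriv:
  assumes "f \<in> schwartz_space S" "v \<in> S"
  shows "dir_deriv v f \<in> schwartz_space S"
proof -
  have "foldr dir_deriv vs (dir_deriv v f) = foldr dir_deriv (vs @ [v]) f" for vs by simp
  moreover have "set (vs @ [v]) \<subseteq> S" if "set vs \<subseteq> S" for vs using that assms by simp
  ultimately show ?thesis
    using assms(1) unfolding schwartz_space_def smooth_on_subspace_def mem_Collect_eq by presburger
qed

lemma schwartz_continuous: "f \<in> schwartz_space S \<Longrightarrow> continuous_on S f"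
  unfolding schwartz_space_def smooth_on_subspace_def by (auto dest: spec[of _ "[]"])

lemma schwartz_measurable: "f \<in> schwartz_space S \<Longrightarrow> f \<in> borel_measurable (subspace_lborel S)"
  unfolding measurable_subspace_lborel_eq
  by (intro borel_measurable_continuous_on_restrict schwartz_continuous)

lemma schwartz_has_dir_deriv:
  assumes S: "subspace S" and f: "f \<in> schwartz_space S" and "x \<in> S" "v \<in> S"
  shows "((\<lambda>t. f (x + t *\<^sub>R v)) has_real_derivative dir_deriv v f (x + s *\<^sub>R v)) (at s)"
proof -
  have "x + s *\<^sub>R v \<in> S" using assms by (intro subspace_add subspace_scale)
  then have "(\<lambda>t. f ((x + s *\<^sub>R v) + t *\<^sub>R v)) differentiable at 0"
    using f \<open>v \<in> S\<close> unfolding schwartz_space_def smooth_on_subspace_def by (auto dest: spec[of _ "[]"])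
  then have "((\<lambda>t. f ((x + s *\<^sub>R v) + t *\<^sub>R v)) has_real_derivative dir_deriv v f (x + s *\<^sub>R v)) (at 0)"
    unfolding dir_deriv_def by (simp add: real_differentiable_def field_differentiable_def DERIV_deriv_iff_field_differentiable)
  then show ?thesis
    using DERIV_shift[of "\<lambda>t. f (x + t *\<^sub>R v)" "dir_deriv v f (x + s *\<^sub>R v)" 0 s]
    by (simp add: scaleR_add_left ac_simps)
qed

text \<open>
  Multiply out using \<open>1 + s \<le> 2 max 1 s\<close>, so that only the seminorms with the powers \<open>0\<close> and
  \<open>2 * p\<close> of the norm are needed.
\<close>
lemma schwartz_decay:
  assumes f: "f \<in> schwartz_space S"
  shows "\<exists>C. \<forall>x\<in>S. \<bar>f x\<bar> \<le> C / (1 + (norm x)\<^sup>2) ^ p"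
proof -
  have bd: "bounded ((\<lambda>x. norm x ^ q * f x) ` S)" for q
    using f unfolding schwartz_space_def by (auto dest: spec[of _ "[]"])
  obtain C0 where C0: "\<And>x. x \<in> S \<Longrightarrow> \<bar>f x\<bar> \<le> C0"
    using bd[of 0] unfolding bounded_iff by auto
  obtain C1 where C1: "\<And>x. x \<in> S \<Longrightarrow> \<bar>norm x ^ (2 * p) * f x\<bar> \<le> C1"
    using bd[of "2 * p"] unfolding bounded_iff by auto
  have "\<bar>f x\<bar> \<le> (2 ^ p * (C0 + C1)) / (1 + (norm x)\<^sup>2) ^ p" if x: "x \<in> S" for x
  proof -
    let ?s = "(norm x)\<^sup>2"
    have "(1 + ?s) ^ p \<le> (2 * max 1 ?s) ^ p" by (intro power_mono) auto
    also have "\<dots> \<le> 2 ^ p * (1 + ?s ^ p)" by (auto simp: power_mult_distrib max_def)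
    finally have "\<bar>f x\<bar> * (1 + ?s) ^ p \<le> \<bar>f x\<bar> * (2 ^ p * (1 + ?s ^ p))"
      by (rule mult_left_mono) simp
    also have "\<dots> = 2 ^ p * (\<bar>f x\<bar> + \<bar>norm x ^ (2 * p) * f x\<bar>)"
      unfolding power_mult abs_mult by (simp add: algebra_simps)
    also have "\<dots> \<le> 2 ^ p * (C0 + C1)"
      using C0[OF x] C1[OF x] by (intro mult_left_mono add_mono) auto
    finally show ?thesis by (simp add: pos_le_divide_eq add_pos_nonneg)
  qed
  then show ?thesis by blast
qed

lemma schwartz_integrable:
  assumes S: "subspace S" and f: "f \<in> schwartz_space S"
  shows "integrable (subspace_lborel S) f"
proof -
  obtain C where "\<And>x. x \<in> S \<Longrightarrow> norm (f x) \<le> C / (1 + (norm x)\<^sup>2) ^ dim S"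
    using schwartz_decay[OF f, of "dim S"] by auto
  then show ?thesis by (intro integrable_of_decay[OF S order_refl schwartz_measurable[OF f]])
qed

lemma measurable_character:
  "(\<lambda>x. exp (\<i> * complex_of_real (x \<bullet> y))) \<in> borel_measurable (subspace_lborel S)"
  by (intro borel_measurable_subspace_lborel) measurable

lemma integrable_character:
  fixes f :: "'a::euclidean_space \<Rightarrow> real"
  assumes "integrable (subspace_lborel S) f"
  shows "integrable (subspace_lborel S) (\<lambda>x. complex_of_real (f x) * exp (\<i> * complex_of_real (x \<bullet> y)))"
proof (rule Bochner_Integration.integrable_bound[OF assms])
  show "(\<lambda>x. complex_of_real (f x) * exp (\<i> * complex_of_real (x \<bullet> y))) \<in> borel_measurable (subspace_lborel S)"
    using borel_measurable_integrable[OF assms] measurable_character by measurable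
qed (simp add: norm_mult)

text \<open>
  Integration by parts without boundary terms. By translation invariance the difference quotient
  of \<open>f\<close> in direction \<open>v\<close> with step \<open>h\<close> has the Fourier transform
  \<open>(exp (- i h (v \<bullet> y)) - 1) / h\<close> times that of \<open>f\<close>. As \<open>h\<close> tends to 0 the factor tends to
  \<open>- i (v \<bullet> y)\<close>, and the mean value theorem with the decay of the derivative dominates the
  difference quotients.
\<close>
lemma fourier_dir_deriv:
  assumes S: "subspace S" and f: "f \<in> schwartz_space S" and v: "v \<in> S"
  shows "fourier_transform S (dir_deriv v f) y = - \<i> * complex_of_real (v \<bullet> y) * fourier_transform S f y"
proof (rule LIMSEQ_unique)
  let ?L = "subspace_lborel S" and ?e = "\<lambda>x. exp (\<i> * complex_of_real (x \<bullet> y))"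
  let ?h = "\<lambda>n. 1 / real (Suc n)"
  let ?s = "\<lambda>n x. complex_of_real ((f (x + ?h n *\<^sub>R v) - f x) / ?h n) * ?e x"
  let ?p = "dim S"
  have h0: "?h \<longlonglongrightarrow> 0" by (rule LIMSEQ_Suc[OF lim_1_over_n])
  have hat0: "filterlim ?h (at 0) sequentially"
    using h0 by (simp add: filterlim_at)
  have fm: "(\<lambda>x. f (x + c *\<^sub>R v)) \<in> borel_measurable ?L" for c
    using measurable_compose[OF measurable_subspace_add[OF S subspace_scale[OF S v, of c]]]
      schwartz_measurable[OF f] unfolding measurable_subspace_lborel_eq by blast
  obtain C where C: "\<And>x. x \<in> S \<Longrightarrow> \<bar>dir_deriv v f x\<bar> \<le> C / (1 + (norm x)\<^sup>2) ^ ?p"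
    using schwartz_decay[OF schwartz_dir_deriv[OF f v], of ?p] by auto
  have C0: "C \<ge> 0" using C[of 0] subspace_0[OF S] by simp
  let ?D = "C * (2 + 2 * (norm v)\<^sup>2) ^ ?p"
  \<comment> \<open>The step lengths are at most 1, so \<open>w = x + z v\<close> satisfies
    \<open>1 + (norm x)\<^sup>2 \<le> (2 + 2 (norm v)\<^sup>2) (1 + (norm w)\<^sup>2)\<close>, which explains the constant.\<close>
  have dom: "norm (?s n x) \<le> ?D * (1 / (1 + (norm x)\<^sup>2) ^ ?p)" if x: "x \<in> S" for n x
  proof -
    obtain z where z: "0 < z" "z < ?h n" "f (x + ?h n *\<^sub>R v) - f (x + 0 *\<^sub>R v) = (?h n - 0) * dir_deriv v f (x + z *\<^sub>R v)"
      using MVT2[of 0 "?h n" "\<lambda>t. f (x + t *\<^sub>R v)" "\<lambda>t. dir_deriv v f (x + t *\<^sub>R v)"]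
        schwartz_has_dir_deriv[OF S f x v] by auto
    let ?w = "x + z *\<^sub>R v"
    have w: "?w \<in> S" using S x v by (intro subspace_add subspace_scale)
    have z1: "z \<le> 1" using z(2) by (rule order_trans[OF less_imp_le]) simp
    have "norm x \<le> norm ?w + norm (z *\<^sub>R v)" using norm_triangle_ineq4[of ?w "z *\<^sub>R v"] by simp
    also have "\<dots> \<le> norm ?w + norm v" using z(1) z1 by (simp add: mult_left_le_one_le)
    finally have "(norm x)\<^sup>2 \<le> (norm ?w + norm v)\<^sup>2" by (intro power_mono) auto
    also have "\<dots> \<le> 2 * (norm ?w)\<^sup>2 + 2 * (norm v)\<^sup>2"
      using sum_squares_bound[of "norm ?w" "norm v"] by (simp add: power2_sum)
    finally have "1 + (norm x)\<^sup>2 \<le> (2 + 2 * (norm v)\<^sup>2) * (1 + (norm ?w)\<^sup>2)"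
      by (simp add: algebra_simps) (smt (verit) zero_le_power2 mult_nonneg_nonneg)
    then have "(1 + (norm x)\<^sup>2) ^ ?p \<le> (2 + 2 * (norm v)\<^sup>2) ^ ?p * (1 + (norm ?w)\<^sup>2) ^ ?p"
      unfolding power_mult_distrib[symmetric] by (rule power_mono) simp
    then have "C * (1 + (norm x)\<^sup>2) ^ ?p \<le> ?D * (1 + (norm ?w)\<^sup>2) ^ ?p"
      using mult_left_mono[OF _ C0] by (simp only: mult.assoc)
    then have *: "C / (1 + (norm ?w)\<^sup>2) ^ ?p \<le> ?D / (1 + (norm x)\<^sup>2) ^ ?p"
      by (simp add: divide_simps add_pos_nonneg)
    have "norm (?s n x) = \<bar>(f (x + ?h n *\<^sub>R v) - f x) / ?h n\<bar>" by (simp only: norm_mult norm_of_real norm_exp_i_times mult_1_right)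
    also have "\<dots> = \<bar>dir_deriv v f ?w\<bar>" using z(3) by simp
    also have "\<dots> \<le> C / (1 + (norm ?w)\<^sup>2) ^ ?p" by (rule C[OF w])
    finally show ?thesis using * by simp
  qed
  show "(\<lambda>n. \<integral>x. ?s n x \<partial>?L) \<longlonglongrightarrow> fourier_transform S (dir_deriv v f) y"
    unfolding fourier_transform_def
  proof (rule integral_dominated_convergence)
    show "(\<lambda>x. complex_of_real (dir_deriv v f x) * ?e x) \<in> borel_measurable ?L"
      using schwartz_measurable[OF schwartz_dir_deriv[OF f v]] measurable_character by measurable
    show "?s n \<in> borel_measurable ?L" for n
      using schwartz_measurable[OF f] fm[of "?h n"] measurable_character by measurable
    show "integrable ?L (\<lambda>x. ?D * (1 / (1 + (norm x)\<^sup>2) ^ ?p))"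
      by (intro integrable_mult_right integrable_polynomial_decay[OF S order_refl])
    show "AE x in ?L. norm (?s n x) \<le> ?D * (1 / (1 + (norm x)\<^sup>2) ^ ?p)" for n
      using dom by (intro AE_I2) simp
    show "AE x in ?L. (\<lambda>n. ?s n x) \<longlonglongrightarrow> complex_of_real (dir_deriv v f x) * ?e x"
    proof (intro AE_I2 tendsto_mult tendsto_const tendsto_of_real)
      fix x assume "x \<in> space ?L"
      then have "((\<lambda>t. (f (x + t *\<^sub>R v) - f x) / t) \<longlongrightarrow> dir_deriv v f x) (at 0)"
        using schwartz_has_dir_deriv[OF S f _ v, of x 0] by (simp add: DERIV_def)
      then show "(\<lambda>n. (f (x + ?h n *\<^sub>R v) - f x) / ?h n) \<longlonglongrightarrow> dir_deriv v f x"
        by (rule filterlim_compose[OF _ hat0])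
    qed
  qed
  let ?c = "- \<i> * complex_of_real (v \<bullet> y)"
  have int: "integrable ?L (\<lambda>x. complex_of_real (f x) * ?e x)"
    by (intro integrable_character schwartz_integrable S f)
  have shifted: "complex_of_real (f (x + t *\<^sub>R v)) * ?e x
      = exp (complex_of_real t * ?c) * (complex_of_real (f (x + t *\<^sub>R v)) * ?e (x + t *\<^sub>R v))" for x t
    by (simp add: inner_add_left mult_exp_exp algebra_simps)
  have int': "integrable ?L (\<lambda>x. complex_of_real (f (x + t *\<^sub>R v)) * ?e (x + t *\<^sub>R v))"
    and eq': "(\<integral>x. complex_of_real (f (x + t *\<^sub>R v)) * ?e (x + t *\<^sub>R v) \<partial>?L) = fourier_transform S f y" for t
  proof -
    have tv: "t *\<^sub>R v \<in> S" by (rule subspace_scale[OF S v])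
    show "(\<integral>x. complex_of_real (f (x + t *\<^sub>R v)) * ?e (x + t *\<^sub>R v) \<partial>?L) = fourier_transform S f y"
      unfolding fourier_transform_def
      using integral_translate[OF S tv borel_measurable_integrable[OF int]] .
    have "(\<lambda>x. x + t *\<^sub>R v) \<in> measurable ?L (restrict_space borel S)"
      unfolding measurable_subspace_lborel_eq by (rule measurable_subspace_add[OF S tv])
    then show "integrable ?L (\<lambda>x. complex_of_real (f (x + t *\<^sub>R v)) * ?e (x + t *\<^sub>R v))"
      using integrable_distr[of "\<lambda>x. x + t *\<^sub>R v" ?L "restrict_space borel S" "\<lambda>x. complex_of_real (f x) * ?e x"] int
      unfolding subspace_lborel_translate[OF S tv] by blast
  qed
  have val: "(\<integral>x. ?s n x \<partial>?L) = (exp (complex_of_real (?h n) * ?c) - 1) / complex_of_real (?h n) * fourier_transform S f y" for n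
  proof -
    have "(\<integral>x. ?s n x \<partial>?L) = (\<integral>x. (exp (complex_of_real (?h n) * ?c) * (complex_of_real (f (x + ?h n *\<^sub>R v)) * ?e (x + ?h n *\<^sub>R v))
        - complex_of_real (f x) * ?e x) / complex_of_real (?h n) \<partial>?L)"
      unfolding shifted[symmetric] by (simp only: of_real_divide of_real_diff left_diff_distrib times_divide_eq_left)
    also have "\<dots> = (exp (complex_of_real (?h n) * ?c) * fourier_transform S f y - fourier_transform S f y) / complex_of_real (?h n)"
      using int int'[of "?h n"] eq'[of "?h n"]
      by (simp only: integral_divide_zero Bochner_Integration.integral_diff integrable_mult_right integral_mult_right_zero)
        (simp only: fourier_transform_def)
    finally show ?thesis by (simp only: left_diff_distrib times_divide_eq_left mult_1)
  qed
  have "((\<lambda>t. exp (t * ?c)) has_field_derivative exp (0 * ?c) * ?c) (at 0)"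
    by (auto intro!: derivative_eq_intros)
  then have "((\<lambda>t. (exp (t * ?c) - 1) / t) \<longlongrightarrow> ?c) (at 0)"
    by (simp add: DERIV_def)
  moreover have "filterlim (\<lambda>n. complex_of_real (?h n)) (at 0) sequentially"
    using tendsto_of_real[OF h0, where 'a=complex] by (simp add: filterlim_at del: of_real_divide)
  ultimately have "(\<lambda>n. (exp (complex_of_real (?h n) * ?c) - 1) / complex_of_real (?h n)) \<longlonglongrightarrow> ?c"
    by (rule filterlim_compose)
  then show "(\<lambda>n. \<integral>x. ?s n x \<partial>?L) \<longlonglongrightarrow> ?c * fourier_transform S f y"
    unfolding val by (intro tendsto_mult tendsto_const)
qed

text \<open>
  Induction on the order of decay for all Schwartz functions at once: multiplication of the Fourier
  transform by \<open>(norm y)\<^sup>2 = \<Sum>b. (y \<bullet> b)\<^sup>2\<close> amounts to transforming the second derivatives along a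
  basis, which are again Schwartz functions.
\<close>
lemma fourier_decay:
  assumes S: "subspace S" and f: "f \<in> schwartz_space S"
  shows "\<exists>C. \<forall>y\<in>S. norm (fourier_transform S f y) \<le> C / (1 + (norm y)\<^sup>2) ^ p"
  using f
proof (induction p arbitrary: f)
  case 0
  have "norm (fourier_transform S f y) \<le> (\<integral>x. norm (complex_of_real (f x) * exp (\<i> * complex_of_real (x \<bullet> y))) \<partial>subspace_lborel S)" for y
    unfolding fourier_transform_def by (rule integral_norm_bound)
  then show ?case by (auto simp: norm_mult)
next
  case (Suc p)
  let ?B = "coord_basis S"
  note B = coord_basis(1,2,4)[OF S]
  let ?g = "\<lambda>b. dir_deriv b (dir_deriv b f)"
  have g: "?g b \<in> schwartz_space S" if "b \<in> ?B" for b
    using that B(3) by (intro schwartz_dir_deriv Suc.prems) auto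
  obtain C where C: "\<And>y. y \<in> S \<Longrightarrow> norm (fourier_transform S f y) \<le> C / (1 + (norm y)\<^sup>2) ^ p"
    using Suc.IH[OF Suc.prems] by blast
  have "\<forall>b\<in>?B. \<exists>C. \<forall>y\<in>S. norm (fourier_transform S (?g b) y) \<le> C / (1 + (norm y)\<^sup>2) ^ p"
    using Suc.IH g by blast
  then obtain K where K: "\<And>b y. b \<in> ?B \<Longrightarrow> y \<in> S \<Longrightarrow> norm (fourier_transform S (?g b) y) \<le> K b / (1 + (norm y)\<^sup>2) ^ p"
    by metis
  have "norm (fourier_transform S f y) \<le> (C + sum K ?B) / (1 + (norm y)\<^sup>2) ^ Suc p" if y: "y \<in> S" for y
  proof -
    let ?F = "fourier_transform S f y"
    have two: "norm (fourier_transform S (?g b) y) = (y \<bullet> b)\<^sup>2 * norm ?F" if "b \<in> ?B" for b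
    proof -
      have b: "b \<in> S" using that B(3) by auto
      show ?thesis
        unfolding fourier_dir_deriv[OF S schwartz_dir_deriv[OF Suc.prems b] b] fourier_dir_deriv[OF S Suc.prems b]
        by (simp add: norm_mult power2_eq_square inner_commute flip: abs_mult)
    qed
    have "(norm y)\<^sup>2 = (\<Sum>b\<in>?B. (y \<bullet> b)\<^sup>2)"
      using orthonormal_norm_sum[OF B(1,2), of "\<lambda>b. y \<bullet> b"] orthonormal_expansion[OF B(1,2) y] by simp
    then have "(1 + (norm y)\<^sup>2) * norm ?F = norm ?F + (\<Sum>b\<in>?B. norm (fourier_transform S (?g b) y))"
      by (simp add: two distrib_right sum_distrib_right)
    also have "\<dots> \<le> C / (1 + (norm y)\<^sup>2) ^ p + (\<Sum>b\<in>?B. K b / (1 + (norm y)\<^sup>2) ^ p)"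
      using C[OF y] K y by (intro add_mono sum_mono) auto
    also have "\<dots> = (C + sum K ?B) / (1 + (norm y)\<^sup>2) ^ p"
      by (simp add: add_divide_distrib sum_divide_distrib)
    finally show ?thesis
      by (simp add: pos_le_divide_eq add_pos_nonneg mult_ac)
  qed
  then show ?case by blast
qed

lemma borel_measurable_fourier_transform:
  assumes S: "subspace S" and f: "f \<in> borel_measurable (subspace_lborel S)"
  shows "fourier_transform S f \<in> borel_measurable borel"
proof -
  interpret sigma_finite_measure "subspace_lborel S" by (rule sigma_finite_subspace_lborel[OF S])
  have [measurable]: "(\<lambda>p. f (snd p)) \<in> borel_measurable (borel \<Otimes>\<^sub>M subspace_lborel S)"
    by (rule measurable_compose[OF measurable_snd f])
  show ?thesis unfolding fourier_transform_def
    by (rule borel_measurable_lebesgue_integral) (simp add: case_prod_unfold)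
qed

section \<open>Integrals over a subspace and its orthogonal complement\<close>

lemma integrable_pair_mult:
  fixes f :: "'a \<Rightarrow> 'c::{real_normed_field, banach, second_countable_topology}" and g :: "'b \<Rightarrow> 'c"
  assumes "pair_sigma_finite M N" and f: "integrable M f" and g: "integrable N g"
  shows "integrable (M \<Otimes>\<^sub>M N) (\<lambda>(x, y). f x * g y)" (is ?I)
    and "(\<integral>(x, y). f x * g y \<partial>(M \<Otimes>\<^sub>M N)) = integral\<^sup>L M f * integral\<^sup>L N g"
proof -
  interpret pair_sigma_finite M N by fact
  have [measurable]: "f \<in> borel_measurable M" "g \<in> borel_measurable N" using f g by auto
  show I: ?I
  proof (rule Fubini_integrable)
    show "integrable M (\<lambda>x. \<integral>y. norm (case (x, y) of (x, y) \<Rightarrow> f x * g y) \<partial>N)"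
      using f by (simp add: norm_mult)
    show "AE x in M. integrable N (\<lambda>y. case (x, y) of (x, y) \<Rightarrow> f x * g y)"
      using g by simp
  qed measurable
  show "(\<integral>(x, y). f x * g y \<partial>(M \<Otimes>\<^sub>M N)) = integral\<^sup>L M f * integral\<^sup>L N g"
    using integral_fst'[OF I] by simp
qed

text \<open>
  The theorem for one function \<open>F\<close> on the whole space in place of a product. This is Fourier
  inversion at the origin of \<open>H\<^sup>\<bottom>\<close> for the function \<open>u \<mapsto> \<integral>\<^sub>H F (y + u) dy\<close>, but that function never
  has to be studied: inserting the factor \<open>gauss (e z)\<close> into the right-hand side, exchanging the
  integrals and evaluating the Gaussian gives an integral of \<open>F (y + e w) gauss w\<close> over
  \<open>H \<times> H\<^sup>\<bottom>\<close>, and both sides converge by domination as \<open>e\<close> tends to 0. On the \<open>H \<times> H\<^sup>\<bottom>\<close> side,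
  orthogonality makes \<open>norm (y + e w) \<ge> norm y\<close>, so one majorant serves all \<open>e\<close>.
\<close>
theorem integral_subspace_eq_integral_fourier:
  fixes F :: "'a::euclidean_space \<Rightarrow> complex" and H :: "'a set"
  assumes H: "subspace H" and cont: "continuous_on UNIV F" and p: "DIM('a) \<le> p"
    and decay: "\<And>x. norm (F x) \<le> C / (1 + (norm x)\<^sup>2) ^ p"
    and Fhat: "\<And>z. Fhat z = (\<integral>x. F x * exp (\<i> * complex_of_real (x \<bullet> z)) \<partial>subspace_lborel UNIV)"
    and int_Fhat: "integrable (subspace_lborel (H\<^sup>\<bottom>)) Fhat"
  shows "(\<integral>y. F y \<partial>subspace_lborel H) = 1 / complex_of_real ((2 * pi) ^ dim (H\<^sup>\<bottom>)) * (\<integral>z. Fhat z \<partial>subspace_lborel (H\<^sup>\<bottom>))"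
proof -
  let ?K = "H\<^sup>\<bottom>" and ?d = "dim (H\<^sup>\<bottom>)"
  let ?LU = "subspace_lborel (UNIV :: 'a set)" and ?LH = "subspace_lborel H" and ?LK = "subspace_lborel (H\<^sup>\<bottom>)"
  have K: "subspace ?K" by (rule subspace_orthogonal_comp)
  have orth: "y \<bullet> u = 0" if "y \<in> H" "u \<in> ?K" for y u
    using that by (auto simp: orthogonal_comp_def orthogonal_def)
  have span: "span (H \<union> ?K) = UNIV" by (rule span_Un_orthogonal_comp[OF H])
  have F[measurable]: "F \<in> borel_measurable borel" by (rule borel_measurable_continuous_onI[OF cont])
  have C0: "C \<ge> 0" using order_trans[OF norm_ge_zero decay[of 0]] by simp
  have dims: "dim H \<le> p" using dim_subset_UNIV[of H] p by simp
  interpret HK: pair_sigma_finite ?LH ?LK by (rule pair_sigma_finite_subspace_lborel[OF H K])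
  interpret UK: pair_sigma_finite ?LU ?LK by (rule pair_sigma_finite_subspace_lborel[OF subspace_UNIV K])
  have intF_U: "integrable ?LU F"
    by (rule integrable_of_decay[OF subspace_UNIV _ _ decay]) (use p in \<open>auto intro: borel_measurable_subspace_lborel\<close>)
  have intF_H: "integrable ?LH F"
    by (rule integrable_of_decay[OF H dims _ decay]) (auto intro: borel_measurable_subspace_lborel)
  define e where "e = (\<lambda>n. 1 / real (Suc n))"
  have e_pos: "e n > 0" for n by (simp add: e_def)
  have e_lim: "e \<longlonglongrightarrow> 0" unfolding e_def by (rule LIMSEQ_Suc[OF lim_1_over_n])
  have gauss_e_lim: "(\<lambda>n. gauss (e n *\<^sub>R z)) \<longlonglongrightarrow> 1" for z :: 'a
  proof -
    have "(\<lambda>n. gauss (e n *\<^sub>R z)) \<longlonglongrightarrow> gauss (0 *\<^sub>R z)"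
      using continuous_gauss[of UNIV] by (intro continuous_on_tendsto_compose[of UNIV gauss] tendsto_scaleR e_lim tendsto_const) auto
    then show ?thesis by (simp add: gauss_def)
  qed
  let ?I = "\<lambda>n. \<integral>z. Fhat z * complex_of_real (gauss (e n *\<^sub>R z)) \<partial>?LK"
  have lim1: "?I \<longlonglongrightarrow> (\<integral>z. Fhat z \<partial>?LK)"
  proof (rule integral_dominated_convergence)
    show "integrable ?LK (\<lambda>z. norm (Fhat z))" using int_Fhat by simp
    show "Fhat \<in> borel_measurable ?LK" using int_Fhat by simp
    moreover have "(\<lambda>z. gauss (e n *\<^sub>R z)) \<in> borel_measurable ?LK" for n
      by (intro borel_measurable_subspace_lborel) measurable
    ultimately show "(\<lambda>z. Fhat z * complex_of_real (gauss (e n *\<^sub>R z))) \<in> borel_measurable ?LK" for n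
      by measurable
    show "AE z in ?LK. norm (Fhat z * complex_of_real (gauss (e n *\<^sub>R z))) \<le> norm (Fhat z)" for n
      by (intro AE_I2) (simp add: gauss_le_1 norm_mult mult_left_le)
    show "AE z in ?LK. (\<lambda>n. Fhat z * complex_of_real (gauss (e n *\<^sub>R z))) \<longlonglongrightarrow> Fhat z"
      using tendsto_mult[OF tendsto_const tendsto_of_real[OF gauss_e_lim]] by (intro AE_I2) simp
  qed
  let ?f = "\<lambda>n (y, w). F (y + e n *\<^sub>R w) * complex_of_real (gauss w)"
  let ?J = "\<lambda>n. integral\<^sup>L (?LH \<Otimes>\<^sub>M ?LK) (?f n)"
  let ?dom = "\<lambda>(y, w). (C * (1 / (1 + (norm y)\<^sup>2) ^ p)) * gauss w"
  have int_dom: "integrable (?LH \<Otimes>\<^sub>M ?LK) ?dom"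
    using integrable_gauss_scaled(1)[OF K, of 1]
    by (intro integrable_pair_mult(1) HK.pair_sigma_finite_axioms integrable_mult_right integrable_polynomial_decay H dims) simp
  have bound: "norm (?f n q) \<le> ?dom q" if in_space: "q \<in> space (?LH \<Otimes>\<^sub>M ?LK)" for n q
  proof -
    obtain y w where q: "q = (y, w)" "y \<in> H" "w \<in> ?K" using in_space by (auto simp: space_pair_measure)
    have "(norm (y + e n *\<^sub>R w))\<^sup>2 = (norm y)\<^sup>2 + (norm (e n *\<^sub>R w))\<^sup>2"
      using orth[OF q(2) subspace_scale[OF K q(3), of "e n"]] by (intro norm_add_Pythagorean) (simp add: orthogonal_def)
    then have "(1 + (norm y)\<^sup>2) ^ p \<le> (1 + (norm (y + e n *\<^sub>R w))\<^sup>2) ^ p"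
      by (intro power_mono) auto
    then have "C / (1 + (norm (y + e n *\<^sub>R w))\<^sup>2) ^ p \<le> C / (1 + (norm y)\<^sup>2) ^ p"
      using C0 by (intro divide_left_mono) (auto intro!: mult_pos_pos zero_less_power add_pos_nonneg)
    then have "norm (F (y + e n *\<^sub>R w)) \<le> C * (1 / (1 + (norm y)\<^sup>2) ^ p)"
      using decay[of "y + e n *\<^sub>R w"] by simp
    then have "norm (F (y + e n *\<^sub>R w)) * gauss w \<le> C * (1 / (1 + (norm y)\<^sup>2) ^ p) * gauss w"
      by (rule mult_right_mono) (rule less_imp_le[OF gauss_pos])
    then show ?thesis by (simp add: q(1) norm_mult)
  qed
  have meas_f: "?f n \<in> borel_measurable (?LH \<Otimes>\<^sub>M ?LK)" for n
    by (auto simp: case_prod_unfold)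
  have int_f: "integrable (?LH \<Otimes>\<^sub>M ?LK) (?f n)" for n
  proof (rule Bochner_Integration.integrable_bound[OF int_dom meas_f AE_I2])
    fix q assume "q \<in> space (?LH \<Otimes>\<^sub>M ?LK)"
    from bound[OF this, of n] show "norm (?f n q) \<le> norm (?dom q)" by (rule order_trans) (simp only: real_norm_def abs_ge_self)
  qed
  \<comment> \<open>The inner Gaussian integral is \<open>(sqrt (2 * pi) / e)^d\<close> times a Gaussian of width \<open>e\<close> in the
    \<open>H\<^sup>\<bottom>\<close> component \<open>u\<close> of \<open>x\<close>; substituting \<open>u = e w\<close> cancels the powers of \<open>e\<close>.\<close>
  have step: "?I n = complex_of_real (sqrt (2 * pi) ^ ?d) * ?J n" for n
  proof -
    let ?c = "complex_of_real ((sqrt (2 * pi) / e n) ^ ?d)"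
    let ?G = "\<lambda>x. F x * (?c * complex_of_real (gauss ((1 / e n) *\<^sub>R orthogonal_proj ?K x)))"
    have G_meas: "?G \<in> borel_measurable borel"
      using borel_measurable_orthogonal_proj[OF K] by measurable
    have int_G: "integrable ?LU ?G"
    proof (rule Bochner_Integration.integrable_bound)
      show "integrable ?LU (\<lambda>x. ?c * F x)" using intF_U by simp
      show "?G \<in> borel_measurable ?LU" by (rule borel_measurable_subspace_lborel[OF G_meas])
      show "AE x in ?LU. norm (?G x) \<le> norm (?c * F x)"
      proof (rule AE_I2)
        fix x
        let ?g = "gauss ((1 / e n) *\<^sub>R orthogonal_proj ?K x)"
        have "norm (?G x) = norm (?c * F x) * ?g"
          unfolding norm_mult norm_of_real abs_gauss by (simp only: mult_ac)
        also have "\<dots> \<le> norm (?c * F x)" by (rule mult_left_le[OF gauss_le_1 norm_ge_zero])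
        finally show "norm (?G x) \<le> norm (?c * F x)" .
      qed
    qed
    have int2: "integrable (?LU \<Otimes>\<^sub>M ?LK) (\<lambda>(x, z). F x * exp (\<i> * complex_of_real (x \<bullet> z)) * complex_of_real (gauss (e n *\<^sub>R z)))"
    proof (rule Bochner_Integration.integrable_bound)
      show "integrable (?LU \<Otimes>\<^sub>M ?LK) (\<lambda>(x, z). F x * complex_of_real (gauss (e n *\<^sub>R z)))"
        by (intro integrable_pair_mult(1) UK.pair_sigma_finite_axioms intF_U integrable_of_real integrable_gauss_scaled K e_pos)
    qed (auto simp: case_prod_unfold norm_mult)
    have "?I n = (\<integral>z. (\<integral>x. F x * exp (\<i> * complex_of_real (x \<bullet> z)) * complex_of_real (gauss (e n *\<^sub>R z)) \<partial>?LU) \<partial>?LK)"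
      unfolding Fhat by simp
    also have "\<dots> = (\<integral>x. (\<integral>z. F x * exp (\<i> * complex_of_real (x \<bullet> z)) * complex_of_real (gauss (e n *\<^sub>R z)) \<partial>?LK) \<partial>?LU)"
      by (rule UK.Fubini_integral[OF int2])
    also have "\<dots> = (\<integral>x. ?G x \<partial>?LU)"
    proof (rule Bochner_Integration.integral_cong[OF refl])
      fix x
      have "(\<integral>z. F x * exp (\<i> * complex_of_real (x \<bullet> z)) * complex_of_real (gauss (e n *\<^sub>R z)) \<partial>?LK)
        = (\<integral>z. F x * (complex_of_real (gauss (e n *\<^sub>R z)) * exp (\<i> * complex_of_real (z \<bullet> x))) \<partial>?LK)"
        by (simp only: mult_ac inner_commute)
      also have "\<dots> = ?G x"
        unfolding integral_mult_right_zero gaussian_fourier[OF K e_pos] of_real_mult ..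
      finally show "(\<integral>z. F x * exp (\<i> * complex_of_real (x \<bullet> z)) * complex_of_real (gauss (e n *\<^sub>R z)) \<partial>?LK) = ?G x" .
    qed
    also have "\<dots> = (\<integral>(y, u). ?G (y + u) \<partial>(?LH \<Otimes>\<^sub>M ?LK))"
      using integral_orthogonal_sum(2)[OF H K _ G_meas] orth unfolding span by blast
    also have "\<dots> = (\<integral>y. (\<integral>u. ?G (y + u) \<partial>?LK) \<partial>?LH)"
    proof -
      have "integrable (?LH \<Otimes>\<^sub>M ?LK) (\<lambda>(y, u). ?G (y + u))"
        using integral_orthogonal_sum(1)[OF H K _ G_meas] orth int_G unfolding span by blast
      then show ?thesis by (rule HK.integral_fst[symmetric])
    qed
    also have "\<dots> = (\<integral>y. complex_of_real (sqrt (2 * pi) ^ ?d) * (\<integral>w. F (y + e n *\<^sub>R w) * complex_of_real (gauss w) \<partial>?LK) \<partial>?LH)"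
    proof (rule Bochner_Integration.integral_cong[OF refl])
      fix y assume "y \<in> space ?LH"
      then have "y \<in> ?K\<^sup>\<bottom>" using orthogonal_comp_subset[of H] by auto
      then have Pu: "orthogonal_proj ?K (y + u) = u" if "u \<in> ?K" for u
        using that by (simp add: linear_add[OF linear_orthogonal_proj[OF K]] orthogonal_proj_0[OF K] orthogonal_proj_ident[OF K])
      let ?h = "\<lambda>u. F (y + u) * complex_of_real (gauss ((1 / e n) *\<^sub>R u))"
      have "(\<integral>u. ?G (y + u) \<partial>?LK) = (\<integral>u. ?c * ?h u \<partial>?LK)"
        by (rule Bochner_Integration.integral_cong[OF refl]) (simp add: Pu)
      also have "\<dots> = complex_of_real (sqrt (2 * pi) ^ ?d) * ((1 / e n ^ ?d) *\<^sub>R (\<integral>u. ?h u \<partial>?LK))"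
        by (simp add: power_divide scaleR_conv_of_real)
      also have "(1 / e n ^ ?d) *\<^sub>R (\<integral>u. ?h u \<partial>?LK) = (\<integral>w. ?h (e n *\<^sub>R w) \<partial>?LK)"
        by (rule integral_scaled[OF K e_pos, symmetric]) measurable
      also have "\<dots> = (\<integral>w. F (y + e n *\<^sub>R w) * complex_of_real (gauss w) \<partial>?LK)"
        using e_pos[of n] by simp
      finally show "(\<integral>u. ?G (y + u) \<partial>?LK) = complex_of_real (sqrt (2 * pi) ^ ?d) * (\<integral>w. F (y + e n *\<^sub>R w) * complex_of_real (gauss w) \<partial>?LK)" .
    qed
    also have "\<dots> = complex_of_real (sqrt (2 * pi) ^ ?d) * ?J n"
      using HK.integral_fst[OF int_f[of n]] by simp
    finally show ?thesis .
  qed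
  have lim2: "?J \<longlonglongrightarrow> (\<integral>(y, w). F y * complex_of_real (gauss w) \<partial>(?LH \<Otimes>\<^sub>M ?LK))"
  proof (rule integral_dominated_convergence[OF _ meas_f int_dom])
    show "AE q in ?LH \<Otimes>\<^sub>M ?LK. norm (?f n q) \<le> ?dom q" for n
      using bound by (intro AE_I2)
    show "(\<lambda>(y, w). F y * complex_of_real (gauss w)) \<in> borel_measurable (?LH \<Otimes>\<^sub>M ?LK)"
      by (auto simp: case_prod_unfold)
    have "(\<lambda>n. F (y + e n *\<^sub>R w) * complex_of_real (gauss w)) \<longlonglongrightarrow> F (y + 0 *\<^sub>R w) * complex_of_real (gauss w)" for y w
      by (intro tendsto_mult tendsto_const continuous_on_tendsto_compose[OF cont] tendsto_add tendsto_scaleR e_lim) auto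
    then show "AE q in ?LH \<Otimes>\<^sub>M ?LK. (\<lambda>n. ?f n q) \<longlonglongrightarrow> (case q of (y, w) \<Rightarrow> F y * complex_of_real (gauss w))"
      by (intro AE_I2) (simp add: case_prod_unfold)
  qed
  have J: "(\<integral>(y, w). F y * complex_of_real (gauss w) \<partial>(?LH \<Otimes>\<^sub>M ?LK)) = (\<integral>y. F y \<partial>?LH) * complex_of_real (sqrt (2 * pi) ^ ?d)"
    using integrable_pair_mult(2)[OF HK.pair_sigma_finite_axioms intF_H integrable_of_real[OF integrable_gauss_scaled(1)[OF K, of 1], where 'a=complex]]
      integrable_gauss_scaled(2)[OF K, of 1] by simp
  have "(\<lambda>n. complex_of_real (sqrt (2 * pi) ^ ?d) * ?J n) \<longlonglongrightarrow> complex_of_real (sqrt (2 * pi) ^ ?d) * ((\<integral>y. F y \<partial>?LH) * complex_of_real (sqrt (2 * pi) ^ ?d))"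
    using lim2 unfolding J by (intro tendsto_mult tendsto_const)
  then have "(\<integral>z. Fhat z \<partial>?LK) = complex_of_real (sqrt (2 * pi) ^ ?d) * ((\<integral>y. F y \<partial>?LH) * complex_of_real (sqrt (2 * pi) ^ ?d))"
    using LIMSEQ_unique[OF lim1] unfolding step by blast
  also have "\<dots> = complex_of_real (sqrt (2 * pi) ^ ?d * sqrt (2 * pi) ^ ?d) * (\<integral>y. F y \<partial>?LH)"
    unfolding of_real_mult by (subst mult.commute[of "integral\<^sup>L _ _"]) (rule mult.assoc[symmetric])
  also have "sqrt (2 * pi) ^ ?d * sqrt (2 * pi) ^ ?d = (2 * pi) ^ ?d"
    unfolding power_mult_distrib[symmetric] by simp
  finally show ?thesis by simp
qed

section \<open>Products over an orthogonal decomposition\<close>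

text \<open>
  On the zero space the Gaussian is constantly 1 and has integral 1, so the measure is the unit
  point mass. This starts the induction over the summands.
\<close>
lemma integral_subspace_lborel_0:
  fixes c :: complex
  shows "integrable (subspace_lborel {0 :: 'a::euclidean_space}) (\<lambda>_. c)"
    and "(\<integral>x. c \<partial>subspace_lborel {0 :: 'a}) = c"
proof -
  let ?L = "subspace_lborel {0 :: 'a}"
  have S: "subspace {0 :: 'a}" by simp
  have eq: "complex_of_real (gauss (1 *\<^sub>R x)) * c = c" if "x \<in> space ?L" for x
    using that by (simp add: gauss_def)
  have "integrable ?L (\<lambda>x. complex_of_real (gauss (1 *\<^sub>R x)) * c)"
    by (intro integrable_mult_left integrable_of_real integrable_gauss_scaled S) simp
  then show "integrable ?L (\<lambda>_. c)"
    by (subst (asm) Bochner_Integration.integrable_cong[OF refl eq])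
  have "(\<integral>x. c \<partial>?L) = (\<integral>x. complex_of_real (gauss (1 *\<^sub>R x)) * c \<partial>?L)"
    by (rule Bochner_Integration.integral_cong[OF refl eq[symmetric]])
  also have "\<dots> = c"
    unfolding integral_mult_left_zero integral_complex_of_real integrable_gauss_scaled(2)[OF S zero_less_one] by simp
  finally show "(\<integral>x. c \<partial>?L) = c" .
qed

lemma borel_measurable_comp_orthogonal_proj:
  assumes S: "subspace S" and g: "g \<in> borel_measurable (subspace_lborel S)"
  shows "(\<lambda>x. g (orthogonal_proj S x)) \<in> borel_measurable borel"
proof (rule measurable_compose[OF _ g])
  show "orthogonal_proj S \<in> measurable borel (subspace_lborel S)"
    unfolding measurable_subspace_lborel_eq
    by (rule measurable_restrict_space2) (auto intro: orthogonal_proj_in[OF S] borel_measurable_orthogonal_proj[OF S])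
qed

text \<open>
  Fubini over an orthogonal decomposition, one summand at a time. Integrability is carried through
  the induction because each step needs it for the factor already treated.
\<close>
lemma integral_prod_orthogonal_proj:
  fixes E :: "'i \<Rightarrow> 'a::euclidean_space set" and g :: "'i \<Rightarrow> 'a \<Rightarrow> complex"
  assumes "finite J" and "\<And>j. j \<in> J \<Longrightarrow> subspace (E j)"
    and "\<And>i j x y. i \<in> J \<Longrightarrow> j \<in> J \<Longrightarrow> i \<noteq> j \<Longrightarrow> x \<in> E i \<Longrightarrow> y \<in> E j \<Longrightarrow> orthogonal x y"
    and "\<And>j. j \<in> J \<Longrightarrow> integrable (subspace_lborel (E j)) (g j)"
  shows "integrable (subspace_lborel (span (\<Union>j\<in>J. E j))) (\<lambda>x. \<Prod>j\<in>J. g j (orthogonal_proj (E j) x)) \<and>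
    (\<integral>x. (\<Prod>j\<in>J. g j (orthogonal_proj (E j) x)) \<partial>subspace_lborel (span (\<Union>j\<in>J. E j)))
      = (\<Prod>j\<in>J. integral\<^sup>L (subspace_lborel (E j)) (g j))"
  using assms
proof (induction J)
  case empty
  show ?case
    using integral_subspace_lborel_0[of 1, where 'a = 'a]
    by (simp only: UN_empty span_empty prod.empty simp_thms)
next
  case (insert i J)
  let ?S = "span (\<Union>j\<in>J. E j)" and ?P = "\<lambda>j. orthogonal_proj (E j)"
  let ?h = "\<lambda>x. \<Prod>j\<in>J. g j (?P j x)" and ?h' = "\<lambda>x. \<Prod>j\<in>insert i J. g j (?P j x)"
  have Ei: "subspace (E i)" and Ej: "\<And>j. j \<in> J \<Longrightarrow> subspace (E j)" using insert.prems by auto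
  have S: "subspace ?S" by simp
  have "integrable (subspace_lborel ?S) ?h \<and>
      integral\<^sup>L (subspace_lborel ?S) ?h = (\<Prod>j\<in>J. integral\<^sup>L (subspace_lborel (E j)) (g j))"
  proof (rule insert.IH)
    show "orthogonal x y" if "i' \<in> J" "j \<in> J" "i' \<noteq> j" "x \<in> E i'" "y \<in> E j" for i' j x y
      using that by (intro insert.prems(2)[of i' j]) auto
  qed (use insert.prems in auto)
  then have IH: "integrable (subspace_lborel ?S) ?h"
      "integral\<^sup>L (subspace_lborel ?S) ?h = (\<Prod>j\<in>J. integral\<^sup>L (subspace_lborel (E j)) (g j))"
    by auto
  have "?S \<subseteq> (E i)\<^sup>\<bottom>"
  proof (rule span_minimal[OF _ subspace_orthogonal_comp])
    show "(\<Union>j\<in>J. E j) \<subseteq> (E i)\<^sup>\<bottom>"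
      using insert.prems(2) insert.hyps by (auto simp: orthogonal_comp_def)
  qed
  then have orth: "y \<in> (E i)\<^sup>\<bottom>" if "y \<in> ?S" for y using that by blast
  then have orth': "x \<bullet> y = 0" if "x \<in> E i" "y \<in> ?S" for x y
    using that by (auto simp: orthogonal_comp_def orthogonal_def)
  have perp: "x \<in> (E j)\<^sup>\<bottom>" if "x \<in> E i" "j \<in> J" for x j
  proof -
    have "j \<noteq> i" using insert.hyps that by blast
    then show ?thesis
      using insert.prems(2)[of j i _ x] that by (simp add: orthogonal_comp_def)
  qed
  have span: "span (\<Union>j\<in>insert i J. E j) = span (E i \<union> ?S)"
    unfolding UN_insert span_Un span_span ..
  have meas: "(\<lambda>x. g j (?P j x)) \<in> borel_measurable borel" if "j \<in> insert i J" for j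
    using insert.prems that by (intro borel_measurable_comp_orthogonal_proj) auto
  then have meas': "?h' \<in> borel_measurable borel" by (intro borel_measurable_prod)
  have split: "?h' (x + y) = g i x * ?h y" if "x \<in> E i" "y \<in> ?S" for x y
  proof -
    have "?P i (x + y) = x"
      by (simp add: linear_add[OF linear_orthogonal_proj[OF Ei]] orthogonal_proj_ident[OF Ei that(1)] orthogonal_proj_0[OF Ei orth[OF that(2)]])
    moreover have "?P j (x + y) = ?P j y" if "j \<in> J" for j
      using that by (simp add: linear_add[OF linear_orthogonal_proj[OF Ej]] orthogonal_proj_0[OF Ej perp[OF \<open>x \<in> E i\<close>]])
    ultimately show ?thesis using insert.hyps by simp
  qed
  note pair = pair_sigma_finite_subspace_lborel[OF Ei S]
  have cong: "(case p of (x, y) \<Rightarrow> ?h' (x + y)) = (case p of (x, y) \<Rightarrow> g i x * ?h y)"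
    if in_space: "p \<in> space (subspace_lborel (E i) \<Otimes>\<^sub>M subspace_lborel ?S)" for p
  proof -
    obtain x y where "p = (x, y)" "x \<in> E i" "y \<in> ?S" using in_space by (auto simp: space_pair_measure)
    with split show ?thesis by (simp only: prod.case)
  qed
  have gi: "integrable (subspace_lborel (E i)) (g i)" using insert.prems by simp
  have "integrable (subspace_lborel (E i) \<Otimes>\<^sub>M subspace_lborel ?S) (\<lambda>(x, y). ?h' (x + y))"
    using integrable_pair_mult(1)[OF pair gi IH(1)]
    by (subst Bochner_Integration.integrable_cong[OF refl cong])
  moreover have "(\<integral>(x, y). ?h' (x + y) \<partial>(subspace_lborel (E i) \<Otimes>\<^sub>M subspace_lborel ?S))
      = (\<Prod>j\<in>insert i J. integral\<^sup>L (subspace_lborel (E j)) (g j))"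
    using integrable_pair_mult(2)[OF pair gi IH(1)] insert.hyps
    by (subst Bochner_Integration.integral_cong[OF refl cong]) (simp_all add: IH(2))
  ultimately show ?case
    unfolding span using integral_orthogonal_sum[OF Ei S orth' meas'] by simp
qed

lemma one_plus_sum_le_prod:
  fixes a :: "'i \<Rightarrow> real"
  assumes "finite J" "\<And>j. j \<in> J \<Longrightarrow> a j \<ge> 0"
  shows "1 + sum a J \<le> (\<Prod>j\<in>J. 1 + a j)"
  using assms
proof (induction J)
  case (insert i J)
  have "1 + sum a (insert i J) \<le> (1 + a i) * (1 + sum a J)"
    using insert by (simp add: algebra_simps sum_nonneg)
  also have "\<dots> \<le> (1 + a i) * (\<Prod>j\<in>J. 1 + a j)"
    using insert by (intro mult_left_mono) auto
  finally show ?case using insert.hyps by simp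
qed simp

text \<open>
  Decay of the factors on the summands gives decay of the product in all directions since
  \<open>1 + (norm x)\<^sup>2 = 1 + (\<Sum>j. (norm (P j x))\<^sup>2) \<le> (\<Prod>j. 1 + (norm (P j x))\<^sup>2)\<close>.
\<close>
lemma prod_orthogonal_proj_decay:
  fixes E :: "'i \<Rightarrow> 'a::euclidean_space set" and \<phi> :: "'i \<Rightarrow> 'a \<Rightarrow> 'b::real_normed_field"
  assumes J: "finite J" and E: "\<And>j. j \<in> J \<Longrightarrow> subspace (E j)"
    and orth: "\<And>i j x y. i \<in> J \<Longrightarrow> j \<in> J \<Longrightarrow> i \<noteq> j \<Longrightarrow> x \<in> E i \<Longrightarrow> y \<in> E j \<Longrightarrow> orthogonal x y"
    and span: "span (\<Union>j\<in>J. E j) = UNIV"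
    and decay: "\<And>j. j \<in> J \<Longrightarrow> \<exists>C. \<forall>x\<in>E j. norm (\<phi> j x) \<le> C / (1 + (norm x)\<^sup>2) ^ p"
  shows "\<exists>C. \<forall>x. norm (\<Prod>j\<in>J. \<phi> j (orthogonal_proj (E j) x)) \<le> C / (1 + (norm x)\<^sup>2) ^ p"
proof -
  obtain C where C: "\<And>j x. j \<in> J \<Longrightarrow> x \<in> E j \<Longrightarrow> norm (\<phi> j x) \<le> C j / (1 + (norm x)\<^sup>2) ^ p"
    using decay by metis
  have C0: "C j \<ge> 0" if "j \<in> J" for j
    using order_trans[OF norm_ge_zero C[OF that subspace_0[OF E[OF that]]]] by simp
  have "norm (\<Prod>j\<in>J. \<phi> j (orthogonal_proj (E j) x)) \<le> prod C J / (1 + (norm x)\<^sup>2) ^ p" for x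
  proof -
    let ?P = "\<lambda>j. orthogonal_proj (E j) x"
    have "(\<Sum>j\<in>J. ?P j) = x" by (rule sum_orthogonal_proj[OF J E orth span])
    then have "(norm x)\<^sup>2 = (\<Sum>j\<in>J. ?P j \<bullet> x)"
      by (metis inner_sum_left power2_norm_eq_inner)
    also have "\<dots> = (\<Sum>j\<in>J. (norm (?P j))\<^sup>2)"
      using inner_orthogonal_proj[OF E orthogonal_proj_in[OF E]]
      by (intro sum.cong refl) (simp add: power2_norm_eq_inner inner_commute)
    finally have "1 + (norm x)\<^sup>2 \<le> (\<Prod>j\<in>J. 1 + (norm (?P j))\<^sup>2)"
      using one_plus_sum_le_prod[OF J, of "\<lambda>j. (norm (?P j))\<^sup>2"] by simp
    then have le: "(1 + (norm x)\<^sup>2) ^ p \<le> (\<Prod>j\<in>J. (1 + (norm (?P j))\<^sup>2) ^ p)"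
      unfolding prod_power_distrib[symmetric] by (intro power_mono) auto
    have "norm (\<Prod>j\<in>J. \<phi> j (?P j)) = (\<Prod>j\<in>J. norm (\<phi> j (?P j)))" by (rule prod_norm[symmetric])
    also have "\<dots> \<le> (\<Prod>j\<in>J. C j / (1 + (norm (?P j))\<^sup>2) ^ p)"
      using C orthogonal_proj_in[OF E] by (intro prod_mono) auto
    also have "\<dots> = prod C J / (\<Prod>j\<in>J. (1 + (norm (?P j))\<^sup>2) ^ p)" by (rule prod_dividef)
    also have "\<dots> \<le> prod C J / (1 + (norm x)\<^sup>2) ^ p"
      using le C0 by (intro divide_left_mono prod_nonneg mult_pos_pos prod_pos zero_less_power) (auto intro: add_pos_nonneg)
    finally show ?thesis .
  qed
  then show ?thesis by blast
qed

lemma fourier_transform_orthogonal_proj: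
  assumes S: "subspace S"
  shows "fourier_transform S f (orthogonal_proj S z) = fourier_transform S f z"
  unfolding fourier_transform_def
proof (rule Bochner_Integration.integral_cong[OF refl])
  fix x assume "x \<in> space (subspace_lborel S)"
  then have "x \<bullet> orthogonal_proj S z = x \<bullet> z"
    using inner_orthogonal_proj[OF S, of x z] by (simp add: inner_commute)
  then show "complex_of_real (f x) * exp (\<i> * complex_of_real (x \<bullet> orthogonal_proj S z))
      = complex_of_real (f x) * exp (\<i> * complex_of_real (x \<bullet> z))" by simp
qed

theorem theorem5:
  fixes m k N :: nat
    and n :: "nat \<Rightarrow> nat"
    and E :: "nat \<Rightarrow> 'a::euclidean_space set"
    and H :: "'a set"
    and f :: "nat \<Rightarrow> 'a \<Rightarrow> real"
  assumes "N = (\<Sum>j=1..m. n j)"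
    and "DIM('a) = N"
    and "\<And>j. j \<in> {1..m} \<Longrightarrow> subspace (E j)"
    and "\<And>j. j \<in> {1..m} \<Longrightarrow> dim (E j) = n j"
    and "\<And>i j x y. \<lbrakk>i \<in> {1..m}; j \<in> {1..m}; i \<noteq> j; x \<in> E i; y \<in> E j\<rbrakk> \<Longrightarrow> orthogonal x y"
    and "span (\<Union>j\<in>{1..m}. E j) = UNIV"
    and "subspace H"
    and "dim H = k"
    and "\<And>j. j \<in> {1..m} \<Longrightarrow> f j \<in> schwartz_space (E j)"
  shows "complex_of_real (\<integral>y. (\<Prod>j=1..m. f j (orthogonal_proj (E j) y)) \<partial>subspace_lborel H) =
    1 / complex_of_real ((2 * pi) ^ (N - k)) *
      (\<integral>z. (\<Prod>j=1..m. fourier_transform (E j) (f j) (orthogonal_proj (E j) z))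
         \<partial>subspace_lborel (H\<^sup>\<bottom>))"
proof -
  note E = assms(3) and orth = assms(5) and span = assms(6) and H = assms(7) and f = assms(9)
  let ?J = "{1..m}" and ?P = "\<lambda>j. orthogonal_proj (E j)" and ?p = "DIM('a)"
  let ?F = "\<lambda>x. \<Prod>j\<in>?J. complex_of_real (f j (?P j x))"
  let ?Fhat = "\<lambda>z. \<Prod>j\<in>?J. fourier_transform (E j) (f j) (?P j z)"
  have cont: "continuous_on UNIV ?F"
  proof (intro continuous_on_prod continuous_on_of_real)
    fix j assume j: "j \<in> ?J"
    show "continuous_on UNIV (\<lambda>x. f j (?P j x))"
      by (rule continuous_on_compose2[OF schwartz_continuous[OF f[OF j]] continuous_orthogonal_proj[OF E[OF j]]])
        (auto intro: orthogonal_proj_in[OF E[OF j]])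
  qed
  have "\<exists>C. \<forall>x. norm (?F x) \<le> C / (1 + (norm x)\<^sup>2) ^ ?p"
    using schwartz_decay[OF f]
    by (intro prod_orthogonal_proj_decay[where \<phi> = "\<lambda>j x. complex_of_real (f j x)"] E orth span) auto
  then obtain C where C: "\<And>x. norm (?F x) \<le> C / (1 + (norm x)\<^sup>2) ^ ?p" by blast
  have "\<exists>C. \<forall>z. norm (?Fhat z) \<le> C / (1 + (norm z)\<^sup>2) ^ ?p"
    using fourier_decay[OF E f] by (intro prod_orthogonal_proj_decay E orth span) auto
  then obtain D where D: "\<And>z. norm (?Fhat z) \<le> D / (1 + (norm z)\<^sup>2) ^ ?p" by blast
  have Fhat: "?Fhat z = (\<integral>x. ?F x * exp (\<i> * complex_of_real (x \<bullet> z)) \<partial>subspace_lborel UNIV)" for z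
  proof -
    let ?e = "\<lambda>x. exp (\<i> * complex_of_real (x \<bullet> z))"
    let ?g = "\<lambda>j x. complex_of_real (f j x) * ?e x"
    have "?Fhat z = (\<Prod>j\<in>?J. integral\<^sup>L (subspace_lborel (E j)) (?g j))"
    proof (rule prod.cong[OF refl])
      fix j assume j: "j \<in> ?J"
      show "fourier_transform (E j) (f j) (?P j z) = integral\<^sup>L (subspace_lborel (E j)) (?g j)"
        unfolding fourier_transform_orthogonal_proj[OF E[OF j]] unfolding fourier_transform_def ..
    qed
    also have "\<dots> = (\<integral>x. (\<Prod>j\<in>?J. ?g j (?P j x)) \<partial>subspace_lborel UNIV)"
      using integral_prod_orthogonal_proj[of ?J E ?g] E orth integrable_character[OF schwartz_integrable[OF E f]]
      unfolding span by simp
    also have "\<dots> = (\<integral>x. ?F x * ?e x \<partial>subspace_lborel UNIV)"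
    proof (rule Bochner_Integration.integral_cong[OF refl])
      fix x
      have "(\<Sum>j\<in>?J. ?P j x) = x" by (rule sum_orthogonal_proj[OF _ E orth span]) auto
      then have "x \<bullet> z = (\<Sum>j\<in>?J. ?P j x \<bullet> z)" by (metis inner_sum_left)
      then have "\<i> * complex_of_real (x \<bullet> z) = (\<Sum>j\<in>?J. \<i> * complex_of_real (?P j x \<bullet> z))"
        by (simp add: sum_distrib_left)
      then have "?e x = (\<Prod>j\<in>?J. ?e (?P j x))" by (simp add: exp_sum)
      then show "(\<Prod>j\<in>?J. ?g j (?P j x)) = ?F x * ?e x" by (simp only: prod.distrib)
    qed
    finally show ?thesis .
  qed
  have K: "subspace (H\<^sup>\<bottom>)" by (rule subspace_orthogonal_comp)
  have int: "integrable (subspace_lborel (H\<^sup>\<bottom>)) ?Fhat"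
  proof (rule integrable_of_decay[OF K dim_subset_UNIV _ D])
    have "?Fhat \<in> borel_measurable borel"
      using borel_measurable_fourier_transform[OF E schwartz_measurable[OF f]]
      by (intro borel_measurable_prod measurable_compose[OF borel_measurable_orthogonal_proj[OF E]]) auto
    then show "?Fhat \<in> borel_measurable (subspace_lborel (H\<^sup>\<bottom>))" by (rule borel_measurable_subspace_lborel)
  qed
  have "dim (H \<union> H\<^sup>\<bottom>) = dim H + dim (H\<^sup>\<bottom>)"
    by (rule dim_orthogonal_sum) (auto simp: orthogonal_comp_def orthogonal_def)
  moreover have "dim (H \<union> H\<^sup>\<bottom>) = N"
    using span_Un_orthogonal_comp[OF H] assms(2) by (metis dim_UNIV dim_span)
  ultimately have dim: "dim (H\<^sup>\<bottom>) = N - k" using assms(8) by simp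
  have "complex_of_real (\<integral>y. (\<Prod>j\<in>?J. f j (?P j y)) \<partial>subspace_lborel H) = (\<integral>y. ?F y \<partial>subspace_lborel H)"
    unfolding of_real_prod[symmetric] integral_complex_of_real ..
  also have "\<dots> = 1 / complex_of_real ((2 * pi) ^ (N - k)) * (\<integral>z. ?Fhat z \<partial>subspace_lborel (H\<^sup>\<bottom>))"
    unfolding dim[symmetric] by (rule integral_subspace_eq_integral_fourier[OF H cont order_refl C Fhat int])
  finally show ?thesis .
qed

end
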